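(* In the Rayleigh fading system model of the context with $M>1$ beams (and any $\rho>0$), the ergodic sum rate $R(\vec p)$ is a Schur-concave function of the feedback probabilities $\vec p\in[0,1]^n$. Consequently, a homogeneous threshold feedback policy solves the threshold selection problem: for every $\lambda\in(0,n]$ and every threshold vector $\vec\tau$ with $\sum_{i=1}^n\Pr\{\gamma_{i,1}\ge\tau_i\}\le\lambda$, there is a homogeneous threshold vector $\vec\tau'=(\tau,\dots,\tau)$ satisfying the same constraint with $R(\vec\tau')\ge R(\vec\tau)$.
   Context: System model: there are $n\ge 2$ users and $M\ge1$ beams. The SINR of user $i$ on beam $m$ is $\gamma_{i,m} = |X_{i,m}|^2 / \big(\tfrac1\rho + \sum_{k\ne m}|X_{i,k}|^2\big)$ with $\rho>0$, where (Rayleigh fading) the $X_{i,k}$ are i.i.d. unit-power circularly symmetric complex Gaussian; users are i.i.d., and the marginal distribution of each $\gamma_{i,m}$ is $F(x) = 1 - e^{-x/\rho}/(x+1)^{M-1}$, $x\ge0$, with density $f(x) = \frac{e^{-x/\rho}}{(x+1)^M}\big[\tfrac1\rho(x+1)+M-1\big]$. Each user $i$ has a threshold $\tau_i\in[0,\infty]$ and truncated SINR $\bar\gamma_{i,m}=\gamma_{i,m}\mathbf 1\{\gamma_{i,m}\ge\tau_i\}$. The ergodic sum rate is $R(\vec\tau) = \mathbb{E}\big[\sum_{m=1}^M\log(1+\max_{1\le i\le n}\bar\gamma_{i,m})\big]$. The feedback probability is $p_i = \Pr\{\gamma_{i,1}\ge\tau_i\}=1-F(\tau_i)$, and $R$ is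 regarded as a function $R(\vec p)$ via $\tau_i=F^{-1}(1-p_i)$ (with $F^{-1}(1)=+\infty$). A threshold vector is homogeneous if all thresholds are equal. Majorization: $\vec x$ majorizes $\vec y$ if the partial sums of the decreasingly ordered coordinates of $\vec x$ dominate those of $\vec y$ and the total sums are equal; $\varphi$ is Schur-concave if $\vec x$ majorizing $\vec y$ implies $\varphi(\vec x)\le\varphi(\vec y)$. *)

theory Defs
  imports "HOL-Probability.Probability"
begin

text \<open>Users are indexed by i < n, beams by m < M (0-based).
  The channel coefficients X(i,k) are i.i.d. unit-power circularly symmetric
  complex Gaussian: density exp(-|z|^2)/pi w.r.t. Lebesgue measure on the complex plane.\<close>

definition cgauss :: "complex measure" where
  "cgauss = density lborel (\<lambda>z. ennreal (exp (- (cmod z)\<^sup>2) / pi))"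

definition channel_model :: "nat \<Rightarrow> nat \<Rightarrow> (nat \<times> nat \<Rightarrow> complex) measure" where
  "channel_model n M = PiM ({..<n} \<times> {..<M}) (\<lambda>_. cgauss)"

definition sinr :: "nat \<Rightarrow> real \<Rightarrow> (nat \<times> nat \<Rightarrow> complex) \<Rightarrow> nat \<Rightarrow> nat \<Rightarrow> real" where
  "sinr M \<rho> X i m = (cmod (X (i, m)))\<^sup>2 / (1 / \<rho> + (\<Sum>k\<in>{..<M} - {m}. (cmod (X (i, k)))\<^sup>2))"

definition trunc_sinr :: "nat \<Rightarrow> real \<Rightarrow> (nat \<Rightarrow> ereal) \<Rightarrow> (nat \<times> nat \<Rightarrow> complex) \<Rightarrow> nat \<Rightarrow> nat \<Rightarrow> real" where
  "trunc_sinr M \<rho> \<tau> X i m = (if \<tau> i \<le> ereal (sinr M \<rho> X i m) then sinr M \<rho> X i m else 0)"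

definition sum_rate :: "nat \<Rightarrow> nat \<Rightarrow> real \<Rightarrow> (nat \<Rightarrow> ereal) \<Rightarrow> real" where
  "sum_rate n M \<rho> \<tau> = integral\<^sup>L (channel_model n M)
     (\<lambda>X. \<Sum>m<M. ln (1 + Max ((\<lambda>i. trunc_sinr M \<rho> \<tau> X i m) ` {..<n})))"

text \<open>Feedback probability Pr{gamma_(i,1) >= tau_i} (beam 1 is index 0).\<close>
definition feedback_prob :: "nat \<Rightarrow> nat \<Rightarrow> real \<Rightarrow> (nat \<Rightarrow> ereal) \<Rightarrow> nat \<Rightarrow> real" where
  "feedback_prob n M \<rho> \<tau> i =
     measure (channel_model n M) {X \<in> space (channel_model n M). \<tau> i \<le> ereal (sinr M \<rho> X i 0)}"

text \<open>Marginal CDF F of each SINR (as given in the system model).\<close>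
definition sinr_cdf :: "nat \<Rightarrow> real \<Rightarrow> real \<Rightarrow> real" where
  "sinr_cdf M \<rho> x = 1 - exp (- x / \<rho>) / (x + 1) ^ (M - 1)"

text \<open>tau = F^{-1}(1 - p), with F^{-1}(1) = +infinity.\<close>
definition tau_of_prob :: "nat \<Rightarrow> real \<Rightarrow> real \<Rightarrow> ereal" where
  "tau_of_prob M \<rho> p = (if p = 0 then PInfty
      else ereal (THE x. 0 \<le> x \<and> sinr_cdf M \<rho> x = 1 - p))"

definition sum_rate_p :: "nat \<Rightarrow> nat \<Rightarrow> real \<Rightarrow> (nat \<Rightarrow> real) \<Rightarrow> real" where
  "sum_rate_p n M \<rho> p = sum_rate n M \<rho> (\<lambda>i. tau_of_prob M \<rho> (p i))"

definition dec_sorted :: "nat \<Rightarrow> (nat \<Rightarrow> real) \<Rightarrow> real list" where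
  "dec_sorted n x = rev (sort (map x [0..<n]))"

definition majorizes :: "nat \<Rightarrow> (nat \<Rightarrow> real) \<Rightarrow> (nat \<Rightarrow> real) \<Rightarrow> bool" where
  "majorizes n x y \<longleftrightarrow>
     (\<forall>k\<le>n. sum_list (take k (dec_sorted n y)) \<le> sum_list (take k (dec_sorted n x)))
     \<and> (\<Sum>i<n. x i) = (\<Sum>i<n. y i)"

definition schur_concave_on :: "nat \<Rightarrow> (nat \<Rightarrow> real) set \<Rightarrow> ((nat \<Rightarrow> real) \<Rightarrow> real) \<Rightarrow> bool" where
  "schur_concave_on n D \<phi> \<longleftrightarrow>
     (\<forall>x\<in>D. \<forall>y\<in>D. majorizes n x y \<longrightarrow> \<phi> x \<le> \<phi> y)"

end

theory Submission
  imports Defs "HOL-Real_Asymp.Real_Asymp"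
begin

text \<open>
  Put \<open>u = ln (1 + x)\<close> and let \<open>F u\<close> be the SINR distribution function in this variable. By
  independence of the users, the rate of one beam is the integral over \<open>u > 0\<close> of
  \<open>1 - (\<Prod>i<n. max (F u) (1 - p i))\<close>. For \<open>M > 1\<close> the function \<open>F\<close> is concave in \<open>u\<close>, and this
  alone makes the rate Schur-concave.

  By a chain of two-coordinate transfers it suffices to replace the values \<open>a \<le> b\<close> of two of the
  \<open>1 - p i\<close> by closer ones \<open>a + \<delta> \<le> b - \<delta>\<close>. With
  \<open>d v = max v a * max v b - max v (a + \<delta>) * max v (b - \<delta>)\<close> and \<open>G\<close> the product of the other
  factors, the rate grows by \<open>\<integral> G u * d (F u) du = \<integral> (G u / F' u) * d (F u) * F' u du\<close>. Here \<open>d\<close>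
  changes sign once, from negative to positive, and the weight \<open>G / F'\<close> is nondecreasing, so this is
  at least a nonnegative multiple of \<open>\<integral> d (F u) * F' u du = \<integral>\<^sub>0\<^sup>1 d v dv\<close>, which is nonnegative by an
  explicit computation.

  Given the interference \<open>I\<close>, the SINR exceeds \<open>x\<close> with probability \<open>exp (- x * (1 / \<rho> + I))\<close>, since
  the squared modulus of a channel coefficient is exponential; averaging this over \<open>I\<close>, a sum of
  \<open>M - 1\<close> independent exponentials, gives \<open>sinr_cdf\<close>.
\<close>

subsection \<open>Majorization by transfers\<close>

lemma length_dec_sorted [simp]: "length (dec_sorted n x) = n"
  by (simp add: dec_sorted_def)

lemma mset_dec_sorted: "mset (dec_sorted n x) = mset (map x [0..<n])"
  by (simp add: dec_sorted_def)

lemma dec_sorted_nth_antimono: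
  assumes "i \<le> j" "j < n"
  shows "dec_sorted n x ! j \<le> dec_sorted n x ! i"
proof -
  have "sorted (rev (dec_sorted n x))" by (simp add: dec_sorted_def)
  thus ?thesis using assms by (simp add: sorted_rev_iff_nth_mono)
qed

lemma sum_list_take_dec_sorted:
  "k \<le> n \<Longrightarrow> sum_list (take k (dec_sorted n x)) = (\<Sum>i<k. dec_sorted n x ! i)"
  by (simp add: sum_list_sum_nth atLeast0LessThan)

lemma sum_dec_sorted: "(\<Sum>i<n. dec_sorted n x ! i) = (\<Sum>i<n. x i)"
proof -
  have "sum_list (dec_sorted n x) = sum_list (map x [0..<n])"
    by (metis mset_dec_sorted sum_mset_sum_list)
  thus ?thesis
    by (simp add: sum_list_sum_nth interv_sum_list_conv_sum_set_nat atLeast0LessThan)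
qed

definition prefix_majorizes :: "nat \<Rightarrow> (nat \<Rightarrow> real) \<Rightarrow> (nat \<Rightarrow> real) \<Rightarrow> bool" where
  "prefix_majorizes n x y \<longleftrightarrow>
     (\<forall>k\<le>n. (\<Sum>i<k. y i) \<le> (\<Sum>i<k. x i)) \<and> (\<Sum>i<n. x i) = (\<Sum>i<n. y i)"

lemma majorizes_iff_prefix_majorizes:
  "majorizes n x y \<longleftrightarrow> prefix_majorizes n (\<lambda>i. dec_sorted n x ! i) (\<lambda>i. dec_sorted n y ! i)"
  by (simp add: majorizes_def prefix_majorizes_def sum_list_take_dec_sorted sum_dec_sorted)

lemma antimono_mean_le_prefix_mean:
  fixes d :: "nat \<Rightarrow> real"
  assumes "\<And>i j. i \<le> j \<Longrightarrow> j < n \<Longrightarrow> d j \<le> d i" and "k \<le> n"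
  shows "k * (\<Sum>i<n. d i) \<le> n * (\<Sum>i<k. d i)"
proof -
  let ?h = "\<lambda>i. if i < k then - 1 else 0 :: real"
  have prefix: "(\<Sum>i=0..<n. ?h i * w i) = - (\<Sum>i<k. w i)" for w
  proof -
    have "(\<Sum>i=0..<n. ?h i * w i) = (\<Sum>i<k. - w i)"
      using assms(2) by (intro sum.mono_neutral_cong_right) auto
    thus ?thesis by (simp add: sum_negf)
  qed
  have "n * (\<Sum>i=0..<n. ?h i * d i) \<le> (\<Sum>i=0..<n. ?h i) * (\<Sum>i=0..<n. d i)"
    using assms by (intro Chebyshev_sum_upper) auto
  thus ?thesis using prefix[of d] prefix[of "\<lambda>_. 1"] by (simp add: atLeast0LessThan)
qed

lemma majorizes_mean:
  assumes "n > 0"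
  shows "majorizes n x (\<lambda>_. (\<Sum>i<n. x i) / n)"
proof -
  define \<mu> where "\<mu> = (\<Sum>i<n. x i) / n"
  have mean_nth: "dec_sorted n (\<lambda>_. \<mu>) ! i = \<mu>" if "i < n" for i
  proof -
    have "dec_sorted n (\<lambda>_. \<mu>) ! i \<in> set (dec_sorted n (\<lambda>_. \<mu>))" using that by simp
    thus ?thesis by (auto simp: dec_sorted_def)
  qed
  have "k * \<mu> \<le> (\<Sum>i<k. dec_sorted n x ! i)" if "k \<le> n" for k
    using antimono_mean_le_prefix_mean[of n "\<lambda>i. dec_sorted n x ! i" k] that assms
    by (simp add: dec_sorted_nth_antimono sum_dec_sorted \<mu>_def field_simps)
  moreover have "n * \<mu> = (\<Sum>i<n. x i)" using assms by (simp add: \<mu>_def)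
  ultimately have "majorizes n x (\<lambda>_. \<mu>)"
    by (simp add: majorizes_iff_prefix_majorizes prefix_majorizes_def sum_dec_sorted mean_nth)
  thus ?thesis by (simp add: \<mu>_def)
qed

lemma prefix_majorizes_excess_before_deficit:
  assumes maj: "prefix_majorizes n x y" and neq: "i < n" "x i \<noteq> y i"
  obtains j k where "j < k" "k < n" "y j < x j" "x k < y k" "\<And>l. l < k \<Longrightarrow> y l \<le> x l"
proof -
  have "\<exists>k. k < n \<and> x k < y k"
  proof (rule ccontr)
    assume "\<nexists>k. k < n \<and> x k < y k"
    hence "\<And>l. l \<in> {..<n} \<Longrightarrow> y l \<le> x l" by (meson lessThan_iff not_less)
    hence "y i = x i"
      using maj neq(1) by (intro sum_mono_inv[of y "{..<n}" x i]) (auto simp: prefix_majorizes_def)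
    thus False using neq(2) by simp
  qed
  then obtain k where k: "k < n" "x k < y k" and before: "\<And>l. l < k \<Longrightarrow> y l \<le> x l"
    by (subst (asm) exists_least_iff) force
  have "\<exists>j<k. y j < x j"
  proof (rule ccontr)
    assume "\<not> (\<exists>j<k. y j < x j)"
    hence "(\<Sum>l<k. x l) \<le> (\<Sum>l<k. y l)" by (intro sum_mono) (meson lessThan_iff not_less)
    hence "(\<Sum>l<Suc k. x l) < (\<Sum>l<Suc k. y l)" using k by simp
    thus False using maj k(1) by (simp add: prefix_majorizes_def Suc_le_eq leD del: sum.lessThan_Suc)
  qed
  thus thesis using that k before by blast
qed

lemma prefix_majorizes_transfer:
  assumes maj: "prefix_majorizes n x y" and jk: "j < k" "k < n"
    and before: "\<And>l. l < k \<Longrightarrow> y l \<le> x l" and \<delta>: "\<delta> \<le> x j - y j"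
  shows "prefix_majorizes n (x(j := x j - \<delta>, k := x k + \<delta>)) y" (is "prefix_majorizes n ?x' y")
proof -
  have "?x' i = x i + (if i = k then \<delta> else 0) - (if i = j then \<delta> else 0)" for i
    using jk by auto
  hence sum_x': "(\<Sum>i<l. ?x' i) = (\<Sum>i<l. x i) + (if k < l then \<delta> else 0) - (if j < l then \<delta> else 0)" for l
    by (simp only: sum.distrib sum_subtractf) (simp add: sum.delta)
  have "(\<Sum>i<l. y i) \<le> (\<Sum>i<l. ?x' i)" if "l \<le> n" for l
  proof (cases "j < l \<and> l \<le> k")
    case True
    thus ?thesis using before \<delta> by (intro sum_mono) auto
  next
    case False
    thus ?thesis using maj that jk sum_x'[of l] by (auto simp: prefix_majorizes_def)
  qed
  moreover have "(\<Sum>i<n. ?x' i) = (\<Sum>i<n. y i)"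
    using maj jk sum_x'[of n] by (simp add: prefix_majorizes_def)
  ultimately show ?thesis by (simp add: prefix_majorizes_def)
qed

definition transfer_mono_on :: "nat \<Rightarrow> real set \<Rightarrow> ((nat \<Rightarrow> real) \<Rightarrow> real) \<Rightarrow> bool" where
  "transfer_mono_on n I \<Phi> \<longleftrightarrow>
     (\<forall>z i j \<delta>. (\<forall>k<n. z k \<in> I) \<and> i < n \<and> j < n \<and> i \<noteq> j \<and> 0 \<le> \<delta> \<and> z j + \<delta> \<le> z i - \<delta>
        \<longrightarrow> \<Phi> z \<le> \<Phi> (z(i := z i - \<delta>, j := z j + \<delta>)))"

text \<open>Only \<open>y\<close> has to be sorted, so the transfers need not keep the intermediate vectors sorted.\<close>

lemma transfer_mono_on_prefix_majorizes:
  assumes I: "is_interval I" and mono: "transfer_mono_on n I \<Phi>"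
    and cong: "\<And>z z'. (\<And>k. k < n \<Longrightarrow> z k = z' k) \<Longrightarrow> \<Phi> z = \<Phi> z'"
    and y_antimono: "\<And>i j. i \<le> j \<Longrightarrow> j < n \<Longrightarrow> y j \<le> y i"
    and "prefix_majorizes n x y" "\<forall>k<n. x k \<in> I"
  shows "\<Phi> x \<le> \<Phi> y"
  using assms(5,6)
proof (induction "card {i. i < n \<and> x i \<noteq> y i}" arbitrary: x rule: less_induct)
  case less
  show ?case
  proof (cases "\<exists>i<n. x i \<noteq> y i")
    case True
    then obtain j k where jk: "j < k" "k < n" "y j < x j" "x k < y k"
      and before: "\<And>l. l < k \<Longrightarrow> y l \<le> x l"
      using prefix_majorizes_excess_before_deficit[OF less.prems(1)] by metis
    define \<delta> where "\<delta> = min (x j - y j) (y k - x k)"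
    define x' where "x' = x(j := x j - \<delta>, k := x k + \<delta>)"
    have \<delta>: "0 < \<delta>" "\<delta> \<le> x j - y j" "\<delta> \<le> y k - x k" using jk by (auto simp: \<delta>_def)
    hence gap: "x k + \<delta> \<le> x j - \<delta>" using y_antimono[of j k] jk by simp
    let ?D = "\<lambda>z. {i. i < n \<and> z i \<noteq> y i}"
    have "x' j = y j \<or> x' k = y k" using jk by (auto simp: x'_def \<delta>_def min_def)
    hence "j \<in> ?D x - ?D x' \<or> k \<in> ?D x - ?D x'" using jk by auto
    moreover have "?D x' \<subseteq> ?D x" using jk(3,4) by (auto simp: x'_def)
    ultimately have "?D x' \<subset> ?D x" by blast
    hence fewer: "card (?D x') < card (?D x)" by (intro psubset_card_mono) simp
    have "x k \<in> I" "x j \<in> I" using less.prems(2) jk by auto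
    from mem_is_interval_1_I[OF I this, of "x k + \<delta>"] mem_is_interval_1_I[OF I this, of "x j - \<delta>"]
    have "x k + \<delta> \<in> I" "x j - \<delta> \<in> I" using gap \<delta>(1) by auto
    hence in_I: "\<forall>i<n. x' i \<in> I" using less.prems(2) by (auto simp: x'_def)
    have "\<Phi> x \<le> \<Phi> x'"
      using mono less.prems(2) jk \<delta>(1) gap unfolding transfer_mono_on_def x'_def by simp
    also have "\<dots> \<le> \<Phi> y"
    proof (rule less.hyps[OF fewer _ in_I])
      show "prefix_majorizes n x' y"
        unfolding x'_def using less.prems(1) jk(1,2) before \<delta>(2) by (rule prefix_majorizes_transfer)
    qed
    finally show ?thesis .
  qed (use cong[of x y] in auto)
qed

lemma schur_concave_onI:
  assumes "is_interval I" "transfer_mono_on n I \<Phi>"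
    and sym: "\<And>z z'. mset (map z [0..<n]) = mset (map z' [0..<n]) \<Longrightarrow> \<Phi> z = \<Phi> z'"
  shows "schur_concave_on n {p. \<forall>i<n. p i \<in> I} \<Phi>"
  unfolding schur_concave_on_def
proof (intro ballI impI)
  fix x y assume x: "x \<in> {p. \<forall>i<n. p i \<in> I}" and maj: "majorizes n x y"
  have sorted: "\<Phi> (\<lambda>i. dec_sorted n z ! i) = \<Phi> z" for z
    by (rule sym) (metis length_dec_sorted map_nth mset_dec_sorted)
  have "\<Phi> (\<lambda>i. dec_sorted n x ! i) \<le> \<Phi> (\<lambda>i. dec_sorted n y ! i)"
  proof (rule transfer_mono_on_prefix_majorizes[OF assms(1,2)])
    show "prefix_majorizes n (\<lambda>i. dec_sorted n x ! i) (\<lambda>i. dec_sorted n y ! i)"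
      using maj by (simp add: majorizes_iff_prefix_majorizes)
    show "\<forall>k<n. dec_sorted n x ! k \<in> I"
    proof (intro allI impI)
      fix k assume "k < n"
      hence "dec_sorted n x ! k \<in> set (dec_sorted n x)" by simp
      also have "\<dots> = x ` {..<n}" by (auto simp: dec_sorted_def)
      finally show "dec_sorted n x ! k \<in> I" using x by auto
    qed
    show "\<Phi> z = \<Phi> z'" if "\<And>k. k < n \<Longrightarrow> z k = z' k" for z z'
      using that by (intro sym arg_cong[of _ _ mset]) auto
  qed (rule dec_sorted_nth_antimono)
  thus "\<Phi> x \<le> \<Phi> y" by (simp add: sorted)
qed

subsection \<open>Truncated maxima under a concave distribution function\<close>

lemma IVT_at_top:
  fixes F :: "real \<Rightarrow> real"
  assumes "continuous_on {a..} F" "(F \<longlongrightarrow> l) at_top" "F a \<le> y" "y < l"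
  obtains x where "a \<le> x" "F x = y"
proof -
  have "\<forall>\<^sub>F x in at_top. y < F x \<and> a \<le> x"
    using order_tendstoD(1)[OF assms(2,4)] eventually_ge_at_top[of a] by (rule eventually_conj)
  then obtain b where "y < F b" "a \<le> b" by (auto dest: eventually_happens)
  moreover have "continuous_on {a..b} F" using assms(1) by (rule continuous_on_subset) auto
  ultimately show thesis using IVT'[of F a y b] assms(3) that by auto
qed

lemma set_integral_single_crossing:
  fixes g w :: "'a::linorder \<Rightarrow> real"
  assumes "set_integrable M A g" "set_integrable M A (\<lambda>x. w x * g x)"
    and w_mono: "mono_on (insert t A) w"
    and below: "\<And>x. x \<in> A \<Longrightarrow> x \<le> t \<Longrightarrow> g x \<le> 0"
    and above: "\<And>x. x \<in> A \<Longrightarrow> t \<le> x \<Longrightarrow> 0 \<le> g x"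
  shows "w t * (LINT x:A|M. g x) \<le> (LINT x:A|M. w x * g x)"
proof -
  have "w t * g x \<le> w x * g x" if "x \<in> A" for x
  proof (cases "x \<le> t")
    case True
    hence "w x \<le> w t" using that by (intro mono_onD[OF w_mono]) auto
    thus ?thesis using below[OF that True] by (rule mult_right_mono_neg)
  next
    case False
    hence "w t \<le> w x" using that by (intro mono_onD[OF w_mono]) auto
    thus ?thesis using above[OF that] False by (intro mult_right_mono) auto
  qed
  hence "(LINT x:A|M. w t * g x) \<le> (LINT x:A|M. w x * g x)"
    using assms(1,2) by (intro set_integral_mono set_integrable_mult_right)
  thus ?thesis by simp
qed

definition transfer_gain :: "real \<Rightarrow> real \<Rightarrow> real \<Rightarrow> real \<Rightarrow> real" where
  "transfer_gain a b \<delta> v = max v a * max v b - max v (a + \<delta>) * max v (b - \<delta>)"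

lemma continuous_on_transfer_gain: "continuous_on A (transfer_gain a b \<delta>)"
  unfolding transfer_gain_def[abs_def] by (intro continuous_intros)

lemma has_integral_max_mult_max:
  fixes a b :: real
  assumes "0 \<le> a" "a \<le> b" "b \<le> 1"
  shows "((\<lambda>v. max v a * max v b) has_integral (a\<^sup>2 * b / 2 + b ^ 3 / 6 + 1 / 3)) {0..1}"
proof -
  have "((\<lambda>v. v * b) has_integral (b\<^sup>2 - a\<^sup>2) / 2 * b) {a..b}"
    using assms by (intro has_integral_mult_left ident_has_integral)
  moreover have "((\<lambda>v. v * v) has_integral (1 ^ 3 / 3 - b ^ 3 / 3)) {b..1}"
    by (rule fundamental_theorem_of_calculus)
       (use assms in \<open>auto intro!: derivative_eq_intros simp: power2_eq_square
          simp flip: has_real_derivative_iff_has_vector_derivative\<close>)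
  moreover have "((\<lambda>v. a * b) has_integral a * (a * b)) {0..a}"
    using has_integral_const_real[of "a * b" 0 a] assms by simp
  ultimately have "((\<lambda>v. max v a * max v b) has_integral a * (a * b)) {0..a}"
    "((\<lambda>v. max v a * max v b) has_integral (b\<^sup>2 - a\<^sup>2) / 2 * b) {a..b}"
    "((\<lambda>v. max v a * max v b) has_integral (1 ^ 3 / 3 - b ^ 3 / 3)) {b..1}"
    using assms by (auto elim!: has_integral_eq[rotated])
  from has_integral_combine[OF _ _ has_integral_combine[OF _ _ this(1,2)] this(3)] show ?thesis
    using assms by (simp add: power2_eq_square power3_eq_cube field_simps)
qed

lemma integral_transfer_gain_nonneg:
  assumes "0 \<le> a" "0 \<le> \<delta>" "a + \<delta> \<le> b - \<delta>" "b \<le> 1"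
  shows "0 \<le> integral {0..1} (transfer_gain a b \<delta>)"
proof -
  let ?I = "\<lambda>x y :: real. x\<^sup>2 * y / 2 + y ^ 3 / 6 + 1 / 3"
  have cubic: "?I x y = 2 / 3 * (((x + y) / 2) ^ 3 + ((y - x) / 2) ^ 3) + 1 / 3" for x y
    by (simp add: power2_eq_square power3_eq_cube field_simps)
  have "((b - \<delta> - (a + \<delta>)) / 2) ^ 3 \<le> ((b - a) / 2) ^ 3" using assms by (intro power_mono) auto
  hence "?I (a + \<delta>) (b - \<delta>) \<le> ?I a b" unfolding cubic by simp
  moreover have "(transfer_gain a b \<delta> has_integral ?I a b - ?I (a + \<delta>) (b - \<delta>)) {0..1}"
    unfolding transfer_gain_def using assms by (intro has_integral_diff has_integral_max_mult_max) auto
  ultimately show ?thesis by (simp only: integral_unique diff_ge_0_iff_ge)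
qed

lemma transfer_gain_single_crossing:
  assumes "0 \<le> a" "0 \<le> \<delta>" "a + \<delta> \<le> b - \<delta>" "0 < b"
  defines "c \<equiv> (a + \<delta>) * (b - \<delta>) / b"
  shows "v \<le> c \<Longrightarrow> transfer_gain a b \<delta> v \<le> 0"
    and "c \<le> v \<Longrightarrow> 0 \<le> transfer_gain a b \<delta> v"
proof -
  have c_mult: "c * b = (a + \<delta>) * (b - \<delta>)" using assms(4) by (simp add: c_def)
  have "0 \<le> \<delta> * (b - \<delta> - a)" using assms by (intro mult_nonneg_nonneg) auto
  hence prod_le: "a * b \<le> (a + \<delta>) * (b - \<delta>)" by (simp add: algebra_simps)
  hence "a * b \<le> c * b" unfolding c_mult .
  hence a_le_c: "a \<le> c" using assms(4) by simp
  have "c * b \<le> (a + \<delta>) * b" unfolding c_mult using assms by (intro mult_left_mono) auto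
  hence c_le: "c \<le> a + \<delta>" using assms(4) by simp
  show "transfer_gain a b \<delta> v \<le> 0" if v: "v \<le> c"
  proof -
    have "v * b \<le> c * b" using v assms(4) by simp
    hence "max v a * b \<le> (a + \<delta>) * (b - \<delta>)" using prod_le c_mult by (simp add: max_def)
    moreover have "v \<le> a + \<delta>" using v c_le by linarith
    ultimately show ?thesis using assms by (simp add: transfer_gain_def max_absorb1 max_absorb2)
  qed
  show "0 \<le> transfer_gain a b \<delta> v" if v: "c \<le> v"
  proof (cases "v \<le> a + \<delta>")
    case True
    have "(a + \<delta>) * (b - \<delta>) \<le> v * b" using v assms(4) by (simp flip: c_mult)
    moreover have "a \<le> v" using a_le_c v by linarith
    ultimately show ?thesis using True assms by (simp add: transfer_gain_def max_absorb1 max_absorb2)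
  next
    case False
    have "v * max v (b - \<delta>) \<le> v * max v b" using False assms by (intro mult_left_mono) auto
    thus ?thesis using False assms by (simp add: transfer_gain_def max_absorb1)
  qed
qed

locale concave_cdf =
  fixes F f :: "real \<Rightarrow> real"
  assumes has_density: "\<And>u. 0 \<le> u \<Longrightarrow> (F has_real_derivative f u) (at u)"
    and density_pos: "\<And>u. 0 \<le> u \<Longrightarrow> 0 < f u"
    and density_antimono: "\<And>u v. 0 \<le> u \<Longrightarrow> u \<le> v \<Longrightarrow> f v \<le> f u"
    and isCont_density: "\<And>u. 0 < u \<Longrightarrow> isCont f u"
    and cdf_0: "F 0 = 0" and cdf_tendsto: "(F \<longlongrightarrow> 1) at_top"
    and tail_integrable: "set_integrable lborel {0<..} (\<lambda>u. 1 - F u)"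
begin

lemma continuous_on_cdf: "continuous_on {0..} F"
  using has_density by (auto intro!: continuous_at_imp_continuous_on DERIV_isCont)

lemma cdf_strict_mono:
  assumes "0 \<le> u" "u < v"
  shows "F u < F v"
proof (rule DERIV_pos_imp_increasing[OF assms(2)])
  show "\<exists>y. (F has_real_derivative y) (at x) \<and> 0 < y" if "u \<le> x" "x \<le> v" for x
    using has_density[of x] density_pos[of x] that assms(1) by auto
qed

lemma cdf_mono: "0 \<le> u \<Longrightarrow> u \<le> v \<Longrightarrow> F u \<le> F v"
  using cdf_strict_mono[of u v] by (cases "u = v") auto

lemma cdf_bounds:
  assumes "0 \<le> u"
  shows "0 \<le> F u" and "F u < 1"
proof -
  show "0 \<le> F u" using cdf_mono[of 0 u] cdf_0 assms by simp
  have "F u < F (u + 1)" using assms by (intro cdf_strict_mono) auto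
  also have "\<forall>\<^sub>F v in at_top. F (u + 1) \<le> F v"
    using eventually_ge_at_top[of "u + 1"] by eventually_elim (use cdf_mono assms in auto)
  hence "F (u + 1) \<le> 1" by (intro tendsto_lowerbound[OF cdf_tendsto]) auto
  finally show "F u < 1" .
qed

lemma cdf_pos: "0 < u \<Longrightarrow> 0 < F u"
  using cdf_strict_mono[of 0 u] cdf_0 by simp

lemma cdf_tendsto_at_right_0: "(F \<longlongrightarrow> 0) (at_right 0)"
  using DERIV_isCont[OF has_density[of 0]] cdf_0 by (simp add: isCont_def filterlim_at_split)

lemma set_integrable_density: "set_integrable lborel {0<..} f"
proof -
  have "set_integrable lborel (einterval 0 \<infinity>) f"
    using has_density density_pos cdf_tendsto_at_right_0 cdf_tendsto isCont_density
    by (intro interval_integral_FTC_nonneg(1)[where F = F])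
       (auto simp: zero_ereal_def ereal_tendsto_simps less_imp_le)
  thus ?thesis by (simp add: zero_ereal_def)
qed

lemma set_integrable_cdf_substitution:
  fixes D :: "real \<Rightarrow> real"
  assumes D: "continuous_on {0..1} D"
  shows "set_integrable lborel {0<..} (\<lambda>u. f u * D (F u))"
proof -
  obtain B where B: "0 \<le> B" "\<And>v. v \<in> {0..1} \<Longrightarrow> norm (D v) \<le> B"
    using continuous_on_compact_bound[OF _ D] by auto
  show ?thesis
  proof (rule set_integrable_bound)
    show "set_integrable lborel {0<..} (\<lambda>u. B * f u)" using set_integrable_density by simp
    have "continuous_on {0<..} (\<lambda>u. f u * D (F u))"
      using cdf_bounds isCont_density
      by (intro continuous_on_mult continuous_on_compose2[OF D]
            continuous_on_subset[OF continuous_on_cdf] continuous_at_imp_continuous_on) (auto simp: less_imp_le)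
    thus "set_borel_measurable lborel {0<..} (\<lambda>u. f u * D (F u))"
      unfolding set_borel_measurable_def measurable_lborel2
      by (intro borel_measurable_continuous_on_indicator) auto
    show "AE u in lborel. u \<in> {0<..} \<longrightarrow> norm (f u * D (F u)) \<le> norm (B * f u)"
    proof (intro AE_I2 impI)
      fix u :: real assume "u \<in> {0<..}"
      hence "\<bar>D (F u)\<bar> \<le> B" using B(2)[of "F u"] cdf_bounds[of u] by simp
      hence "\<bar>D (F u)\<bar> * \<bar>f u\<bar> \<le> B * \<bar>f u\<bar>" by (rule mult_right_mono) simp
      thus "norm (f u * D (F u)) \<le> norm (B * f u)" using B(1) by (simp add: abs_mult mult.commute)
    qed
  qed
qed

lemma integral_cdf_substitution:
  fixes D :: "real \<Rightarrow> real"
  assumes D: "continuous_on {0..1} D"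
  shows "(LINT u:{0<..}|lborel. f u * D (F u)) = integral {0..1} D"
proof -
  have D_int: "set_integrable lborel {0..1} D" using D by (rule borel_integrable_atLeastAtMost')
  have "(LBINT v=0..1. D v) = (LBINT u=0..\<infinity>. f u *\<^sub>R D (F u))"
  proof (rule interval_integral_substitution_integrable[where g = F])
    show "((ereal \<circ> F \<circ> real_of_ereal) \<longlongrightarrow> 0) (at_right 0)"
      "((ereal \<circ> F \<circ> real_of_ereal) \<longlongrightarrow> 1) (at_left \<infinity>)"
      using cdf_tendsto_at_right_0 cdf_tendsto
      by (auto simp: zero_ereal_def one_ereal_def ereal_tendsto_simps o_assoc)
    show "isCont D (F u)" if "0 < ereal u" for u
      using continuous_on_interior[OF D, of "F u"] cdf_pos[of u] cdf_bounds(2)[of u] that by simp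
    show "set_integrable lborel (einterval 0 \<infinity>) (\<lambda>u. f u *\<^sub>R D (F u))"
      using set_integrable_cdf_substitution[OF D] by (simp add: zero_ereal_def)
    show "set_integrable lborel (einterval 0 1) D"
      by (rule set_integrable_subset[OF D_int]) (auto simp: einterval_def)
  qed (use has_density density_pos isCont_density in \<open>auto simp: less_imp_le\<close>)
  thus ?thesis
    using interval_integral_to_infinity_eq[of lborel 0 "\<lambda>u. f u * D (F u)"]
      interval_integral_eq_integral[OF _ D_int]
    by (simp add: zero_ereal_def one_ereal_def)
qed

lemma transfer_gain_crossing_point:
  assumes "0 \<le> a" "0 < \<delta>" "a + \<delta> \<le> b - \<delta>" "b \<le> 1"
  obtains t where "0 \<le> t"
    and "\<And>u. 0 \<le> u \<Longrightarrow> u \<le> t \<Longrightarrow> transfer_gain a b \<delta> (F u) \<le> 0"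
    and "\<And>u. t \<le> u \<Longrightarrow> 0 \<le> transfer_gain a b \<delta> (F u)"
proof -
  have b: "0 < b" using assms by simp
  define c where "c = (a + \<delta>) * (b - \<delta>) / b"
  have "(a + \<delta>) * (b - \<delta>) \<le> b - \<delta>" using assms by (intro mult_left_le_one_le) auto
  hence "(a + \<delta>) * (b - \<delta>) < b" using assms(2) by linarith
  hence "0 \<le> c" "c < 1" using b assms by (auto simp: c_def divide_less_eq)
  then obtain t where t: "0 \<le> t" "F t = c"
    using IVT_at_top[OF continuous_on_cdf cdf_tendsto] cdf_0 by metis
  note crossing =
    transfer_gain_single_crossing[OF assms(1) less_imp_le[OF assms(2)] assms(3) b, folded c_def]
  show thesis
  proof (rule that[OF t(1)])
    show "transfer_gain a b \<delta> (F u) \<le> 0" if "0 \<le> u" "u \<le> t" for u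
      using cdf_mono[OF that] t(2) by (intro crossing(1)) simp
    show "0 \<le> transfer_gain a b \<delta> (F u)" if "t \<le> u" for u
      using cdf_mono[OF t(1) that] t(2) by (intro crossing(2)) simp
  qed
qed

lemma integral_weighted_transfer_gain_nonneg:
  assumes G_mono: "mono_on {0..} G" and G_nonneg: "\<And>u. 0 \<le> u \<Longrightarrow> 0 \<le> G u"
    and transfer: "0 \<le> a" "0 \<le> \<delta>" "a + \<delta> \<le> b - \<delta>" "b \<le> 1"
    and int: "set_integrable lborel {0<..} (\<lambda>u. G u * transfer_gain a b \<delta> (F u))"
  shows "0 \<le> (LINT u:{0<..}|lborel. G u * transfer_gain a b \<delta> (F u))"
proof (cases "\<delta> = 0")
  case True
  thus ?thesis by (simp add: transfer_gain_def)
next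
  case False
  then obtain t where t: "0 \<le> t"
    and below: "\<And>u. 0 \<le> u \<Longrightarrow> u \<le> t \<Longrightarrow> transfer_gain a b \<delta> (F u) \<le> 0"
    and above: "\<And>u. t \<le> u \<Longrightarrow> 0 \<le> transfer_gain a b \<delta> (F u)"
    using transfer_gain_crossing_point[OF transfer(1) _ transfer(3,4)] transfer(2) by (metis less_le)
  let ?weight = "\<lambda>u. G u / f u"
  have cancel: "?weight u * (f u * x) = G u * x" if "u \<in> {0<..}" for u x
    using density_pos[of u] that by simp
  have "0 \<le> ?weight t * integral {0..1} (transfer_gain a b \<delta>)"
    using G_nonneg[OF t] density_pos[OF t] transfer
    by (intro mult_nonneg_nonneg integral_transfer_gain_nonneg) auto
  also have "\<dots> = ?weight t * (LINT u:{0<..}|lborel. f u * transfer_gain a b \<delta> (F u))"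
    by (simp add: integral_cdf_substitution continuous_on_transfer_gain)
  also have "\<dots> \<le> (LINT u:{0<..}|lborel. ?weight u * (f u * transfer_gain a b \<delta> (F u)))"
  proof (rule set_integral_single_crossing)
    have "set_integrable lborel {0<..} (\<lambda>u. ?weight u * (f u * transfer_gain a b \<delta> (F u)))
        \<longleftrightarrow> set_integrable lborel {0<..} (\<lambda>u. G u * transfer_gain a b \<delta> (F u))"
      by (intro set_integrable_cong refl cancel)
    thus "set_integrable lborel {0<..} (\<lambda>u. ?weight u * (f u * transfer_gain a b \<delta> (F u)))"
      using int by (rule iffD2)
    show "mono_on (insert t {0<..}) ?weight"
      using t mono_onD[OF G_mono] G_nonneg density_pos density_antimono
      by (intro mono_onI frac_le) auto
  qed (use t below above density_pos in \<open>auto simp: mult_le_0_iff less_imp_le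
      intro: set_integrable_cdf_substitution continuous_on_transfer_gain\<close>)
  also have "\<dots> = (LINT u:{0<..}|lborel. G u * transfer_gain a b \<delta> (F u))"
    by (intro set_lebesgue_integral_cong allI impI cancel) auto
  finally show ?thesis .
qed

end

text \<open>The probability that the maximum of \<open>n\<close> independent variables with distribution function \<open>F\<close>,
  the \<open>i\<close>-th one set to \<open>0\<close> below its \<open>(1 - p i)\<close>-quantile, is at least \<open>u > 0\<close>.\<close>

definition trunc_max_tail :: "(real \<Rightarrow> real) \<Rightarrow> nat \<Rightarrow> (nat \<Rightarrow> real) \<Rightarrow> real \<Rightarrow> real" where
  "trunc_max_tail F n p u = 1 - (\<Prod>i<n. max (F u) (1 - p i))"

definition trunc_max_mean :: "(real \<Rightarrow> real) \<Rightarrow> nat \<Rightarrow> (nat \<Rightarrow> real) \<Rightarrow> real" where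
  "trunc_max_mean F n p = (LINT u:{0<..}|lborel. trunc_max_tail F n p u)"

lemma trunc_max_mean_cong:
  "(\<And>i. i < n \<Longrightarrow> p i = q i) \<Longrightarrow> trunc_max_mean F n p = trunc_max_mean F n q"
  by (simp add: trunc_max_mean_def trunc_max_tail_def cong: prod.cong_simp)

context concave_cdf
begin

lemma trunc_max_tail_bounds:
  assumes "0 \<le> u" "\<forall>i<n. 0 \<le> p i"
  shows "0 \<le> trunc_max_tail F n p u" and "trunc_max_tail F n p u \<le> n * (1 - F u)"
proof -
  note F = cdf_bounds[OF assms(1)]
  have "(\<Prod>i<n. max (F u) (1 - p i)) \<le> 1" using F assms by (intro prod_le_1) auto
  thus "0 \<le> trunc_max_tail F n p u" by (simp add: trunc_max_tail_def)
  have "1 + n * (F u - 1) \<le> (1 + (F u - 1)) ^ n" using F by (intro Bernoulli_inequality) auto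
  also have "\<dots> = (\<Prod>i<n. F u)" by simp
  also have "\<dots> \<le> (\<Prod>i<n. max (F u) (1 - p i))" using F by (intro prod_mono) auto
  finally show "trunc_max_tail F n p u \<le> n * (1 - F u)"
    by (simp add: trunc_max_tail_def algebra_simps)
qed

lemma set_integrable_trunc_max_tail:
  assumes "\<forall>i<n. 0 \<le> p i"
  shows "set_integrable lborel {0<..} (trunc_max_tail F n p)"
proof (rule set_integrable_bound)
  show "set_integrable lborel {0<..} (\<lambda>u. n * (1 - F u))" using tail_integrable by simp
  have "continuous_on {0<..} F" using continuous_on_cdf by (rule continuous_on_subset) auto
  hence "continuous_on {0<..} (trunc_max_tail F n p)"
    unfolding trunc_max_tail_def[abs_def] by (intro continuous_intros)
  thus "set_borel_measurable lborel {0<..} (trunc_max_tail F n p)"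
    unfolding set_borel_measurable_def measurable_lborel2
    by (intro borel_measurable_continuous_on_indicator) auto
  show "AE u in lborel. u \<in> {0<..} \<longrightarrow> norm (trunc_max_tail F n p u) \<le> norm (n * (1 - F u))"
  proof (intro AE_I2 impI)
    fix u :: real assume "u \<in> {0<..}"
    hence "0 \<le> trunc_max_tail F n p u" "trunc_max_tail F n p u \<le> n * (1 - F u)"
      using trunc_max_tail_bounds[OF _ assms, of u] by auto
    thus "norm (trunc_max_tail F n p u) \<le> norm (n * (1 - F u))"
      unfolding real_norm_def by (metis abs_of_nonneg order_trans)
  qed
qed

lemma
  assumes "\<forall>i<n. 0 \<le> p i"
  shows trunc_max_mean_nonneg: "0 \<le> trunc_max_mean F n p"
    and nn_integral_trunc_max_tail:
      "(\<integral>\<^sup>+u\<in>{0<..}. ennreal (trunc_max_tail F n p u) \<partial>lborel) = ennreal (trunc_max_mean F n p)"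
proof -
  let ?g = "\<lambda>u. trunc_max_tail F n p u * indicator {0<..} u"
  have nonneg: "0 \<le> ?g u" for u
    using trunc_max_tail_bounds(1)[of u n p] assms by (simp split: split_indicator)
  have mean: "trunc_max_mean F n p = (\<integral>u. ?g u \<partial>lborel)"
    by (simp add: trunc_max_mean_def set_lebesgue_integral_def mult.commute)
  show "0 \<le> trunc_max_mean F n p" unfolding mean using nonneg by simp
  have "integrable lborel ?g"
    using set_integrable_trunc_max_tail[OF assms] by (simp add: set_integrable_def mult.commute)
  thus "(\<integral>\<^sup>+u\<in>{0<..}. ennreal (trunc_max_tail F n p u) \<partial>lborel) = ennreal (trunc_max_mean F n p)"
    unfolding nn_integral_set_ennreal mean using nonneg by (intro nn_integral_eq_integral) auto
qed

lemma trunc_max_tail_transfer: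
  assumes "i < n" "j < n" "i \<noteq> j"
  shows "trunc_max_tail F n (z(i := z i - \<delta>, j := z j + \<delta>)) u - trunc_max_tail F n z u
    = (\<Prod>k\<in>{..<n} - {i, j}. max (F u) (1 - z k)) * transfer_gain (1 - z i) (1 - z j) \<delta> (F u)"
proof -
  let ?z' = "z(i := z i - \<delta>, j := z j + \<delta>)"
  let ?others = "\<lambda>p. \<Prod>k\<in>{..<n} - {i, j}. max (F u) (1 - p k)"
  have users: "{..<n} = insert i (insert j ({..<n} - {i, j}))" using assms by auto
  have tail: "trunc_max_tail F n p u = 1 - ?others p * (max (F u) (1 - p i) * max (F u) (1 - p j))" for p
    unfolding trunc_max_tail_def using assms(3) by (subst users) (simp add: mult_ac)
  have "?others ?z' = ?others z" by (intro prod.cong) auto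
  moreover have "1 - ?z' i = 1 - z i + \<delta>" "1 - ?z' j = 1 - z j - \<delta>" using assms(3) by auto
  ultimately show ?thesis
    unfolding tail transfer_gain_def by (simp only: right_diff_distrib)
qed

lemma transfer_mono_on_trunc_max_mean: "transfer_mono_on n {0..1} (trunc_max_mean F n)"
  unfolding transfer_mono_on_def
proof (intro allI impI, elim conjE)
  fix z i j and \<delta> :: real
  assume box: "\<forall>k<n. z k \<in> {0..1}" and ij: "i < n" "j < n" "i \<noteq> j"
    and \<delta>: "0 \<le> \<delta>" "z j + \<delta> \<le> z i - \<delta>"
  let ?z' = "z(i := z i - \<delta>, j := z j + \<delta>)"
  let ?G = "\<lambda>u. \<Prod>k\<in>{..<n} - {i, j}. max (F u) (1 - z k)"
  have zij: "0 \<le> z j" "z i \<le> 1" using box ij by auto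
  have "set_integrable lborel {0<..} (trunc_max_tail F n ?z')"
    "set_integrable lborel {0<..} (trunc_max_tail F n z)"
    using box \<delta> zij by (auto intro!: set_integrable_trunc_max_tail)
  note diff = set_integral_diff[OF this, unfolded trunc_max_tail_transfer[OF ij]]
  have "0 \<le> (LINT u:{0<..}|lborel. ?G u * transfer_gain (1 - z i) (1 - z j) \<delta> (F u))"
  proof (rule integral_weighted_transfer_gain_nonneg[OF _ _ _ _ _ _ diff(1)])
    show "mono_on {0..} ?G"
    proof (intro mono_onI prod_mono)
      fix u v :: real and k assume "u \<in> {0..}" "u \<le> v"
      thus "0 \<le> max (F u) (1 - z k) \<and> max (F u) (1 - z k) \<le> max (F v) (1 - z k)"
        using cdf_mono[of u v] cdf_bounds(1)[of u] by auto
    qed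
    show "0 \<le> ?G u" if "0 \<le> u" for u
      using cdf_bounds(1)[OF that] by (intro prod_nonneg) (auto simp: le_max_iff_disj)
  qed (use \<delta> zij in auto)
  also have "\<dots> = trunc_max_mean F n ?z' - trunc_max_mean F n z"
    unfolding trunc_max_mean_def by (rule diff(2))
  finally show "trunc_max_mean F n z \<le> trunc_max_mean F n ?z'" by simp
qed

lemma schur_concave_trunc_max_mean:
  "schur_concave_on n {p. \<forall>i<n. p i \<in> {0..1}} (trunc_max_mean F n)"
proof (rule schur_concave_onI[OF _ transfer_mono_on_trunc_max_mean])
  fix z z' :: "nat \<Rightarrow> real"
  assume same_values: "mset (map z [0..<n]) = mset (map z' [0..<n])"
  have "(\<Prod>i<n. g (w i)) = prod_mset (image_mset g (mset (map w [0..<n])))" for g w :: "_ \<Rightarrow> real"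
    by (simp add: prod_unfold_prod_mset atLeast0LessThan image_mset.compositionality o_def)
  hence "(\<Prod>i<n. g (z i)) = (\<Prod>i<n. g (z' i))" for g :: "real \<Rightarrow> real" by (simp only: same_values)
  from this[of "\<lambda>y. max _ (1 - y)"] show "trunc_max_mean F n z = trunc_max_mean F n z'"
    unfolding trunc_max_mean_def trunc_max_tail_def by simp
qed (rule is_interval_cc)

end

subsection \<open>Independent and exponential variables\<close>

lemma (in sigma_finite_measure) nn_integral_layer_cake:
  fixes Y :: "'a \<Rightarrow> real"
  assumes [measurable]: "Y \<in> borel_measurable M"
  shows "(\<integral>\<^sup>+x. ennreal (Y x) \<partial>M) = (\<integral>\<^sup>+u\<in>{0<..}. emeasure M {x \<in> space M. u \<le> Y x} \<partial>lborel)"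
proof -
  interpret pair_sigma_finite M lborel
    by (intro pair_sigma_finite.intro) (auto intro: sigma_finite_measure_axioms sigma_finite_lborel)
  have "(\<integral>\<^sup>+x. ennreal (Y x) \<partial>M) = (\<integral>\<^sup>+x. (\<integral>\<^sup>+u. indicator {u. 0 < u \<and> u \<le> Y x} u \<partial>lborel) \<partial>M)"
  proof (rule nn_integral_cong)
    fix x
    have "{u. 0 < u \<and> u \<le> Y x} = {0<..Y x}" by auto
    thus "ennreal (Y x) = (\<integral>\<^sup>+u. indicator {u. 0 < u \<and> u \<le> Y x} u \<partial>lborel)"
      by (cases "0 \<le> Y x") (simp_all add: ennreal_neg)
  qed
  also have "\<dots> = (\<integral>\<^sup>+u. (\<integral>\<^sup>+x. indicator {u. 0 < u \<and> u \<le> Y x} u \<partial>M) \<partial>lborel)"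
    by (rule Fubini'[symmetric]) measurable
  also have "\<dots> = (\<integral>\<^sup>+u\<in>{0<..}. emeasure M {x \<in> space M. u \<le> Y x} \<partial>lborel)"
  proof (rule nn_integral_cong)
    fix u :: real
    have "(\<integral>\<^sup>+x. indicator {u. 0 < u \<and> u \<le> Y x} u \<partial>M)
        = (\<integral>\<^sup>+x. indicator {x \<in> space M. u \<le> Y x} x * indicator {0<..} u \<partial>M)"
      by (intro nn_integral_cong) (auto simp: indicator_def)
    also have "\<dots> = emeasure M {x \<in> space M. u \<le> Y x} * indicator {0<..} u"
      by (subst nn_integral_multc) auto
    finally show "(\<integral>\<^sup>+x. indicator {u. 0 < u \<and> u \<le> Y x} u \<partial>M)
        = emeasure M {x \<in> space M. u \<le> Y x} * indicator {0<..} u" .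
  qed
  finally show ?thesis .
qed

lemma (in prob_space) prob_Max_less:
  fixes X :: "'i \<Rightarrow> 'a \<Rightarrow> real"
  assumes "indep_vars (\<lambda>_. borel) X I" "finite I" "I \<noteq> {}"
  shows "prob {\<omega> \<in> space M. Max ((\<lambda>i. X i \<omega>) ` I) < x} = (\<Prod>i\<in>I. prob {\<omega> \<in> space M. X i \<omega> < x})"
proof -
  have less: "{\<omega> \<in> space M. X i \<omega> < x} = X i -` {..<x} \<inter> space M" for i by auto
  have "{\<omega> \<in> space M. Max ((\<lambda>i. X i \<omega>) ` I) < x} = (\<Inter>i\<in>I. X i -` {..<x} \<inter> space M)"
    using assms(2,3) by auto
  thus ?thesis unfolding less using indep_varsD_finite[OF assms(1,3,2)] by simp
qed

lemma (in product_prob_space) indep_vars_components: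
  assumes "I \<noteq> {}"
  shows "P.indep_vars M (\<lambda>i \<omega>. \<omega> i) I"
proof -
  have "distr (PiM I M) (PiM I M) (\<lambda>\<omega>. \<lambda>i\<in>I. \<omega> i) = distr (PiM I M) (PiM I M) (\<lambda>\<omega>. \<omega>)"
    by (intro distr_cong) (auto simp: space_PiM PiE_def extensional_restrict)
  also have "\<dots> = PiM I (\<lambda>i. distr (PiM I M) (M i) (\<lambda>\<omega>. \<omega> i))"
    by (simp add: PiM_component cong: PiM_cong)
  finally show ?thesis
    using assms by (subst P.indep_vars_iff_distr_eq_PiM') auto
qed

lemma (in prob_space) exponential_distributedD_ge:
  assumes D: "distributed M lborel Y (exponential_density l)" and "0 \<le> a" "0 < l"
  shows "prob {\<omega> \<in> space M. a \<le> Y \<omega>} = exp (- a * l)"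
proof -
  have [measurable]: "Y \<in> borel_measurable M" using distributed_measurable[OF D] by simp
  have "AE \<omega> in M. Y \<omega> \<noteq> a"
    by (subst distributed_AE2[OF D]) (use AE_lborel_singleton[of a] in auto)
  hence "prob {\<omega> \<in> space M. a \<le> Y \<omega>} = prob {\<omega> \<in> space M. a < Y \<omega>}"
    by (intro finite_measure_eq_AE) auto
  thus ?thesis using exponential_distributedD_gt[OF D] assms by simp
qed

lemma (in prob_space) exponential_distributed_nonneg:
  assumes "distributed M lborel Y (exponential_density l)"
  shows "AE \<omega> in M. 0 \<le> Y \<omega>"
  by (subst distributed_AE2[OF assms]) (auto simp: exponential_density_def)

lemma (in prob_space) exponential_distributed_laplace:
  assumes D: "distributed M lborel Y (exponential_density l)" and "0 < l" "0 \<le> a"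
  shows "(\<integral>\<^sup>+\<omega>. ennreal (exp (- a * Y \<omega>)) \<partial>M) = ennreal (l / (l + a))"
proof -
  interpret tilted: prob_space "density lborel (exponential_density (l + a))"
    using assms by (intro prob_space_exponential_density) simp
  have "(\<integral>\<^sup>+\<omega>. ennreal (exp (- a * Y \<omega>)) \<partial>M)
      = (\<integral>\<^sup>+s. ennreal (exponential_density l s) * ennreal (exp (- a * s)) \<partial>lborel)"
    by (rule distributed_nn_integral[OF D, symmetric]) simp
  also have "\<dots> = (\<integral>\<^sup>+s. ennreal (l / (l + a)) * ennreal (exponential_density (l + a) s) \<partial>lborel)"
  proof (rule nn_integral_cong)
    fix s
    have "exp (- s * l) * exp (- a * s) = exp (- s * (l + a))"
      by (simp add: algebra_simps flip: exp_add)
    hence "exponential_density l s * exp (- a * s) = l / (l + a) * exponential_density (l + a) s"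
      using assms by (simp add: exponential_density_def)
    thus "ennreal (exponential_density l s) * ennreal (exp (- a * s))
        = ennreal (l / (l + a)) * ennreal (exponential_density (l + a) s)"
      using assms by (simp flip: ennreal_mult' ennreal_mult'')
  qed
  also have "\<dots> = ennreal (l / (l + a)) * (\<integral>\<^sup>+s. ennreal (exponential_density (l + a) s) \<partial>lborel)"
    by (rule nn_integral_cmult) simp
  also have "(\<integral>\<^sup>+s. ennreal (exponential_density (l + a) s) \<partial>lborel) = 1"
    using tilted.emeasure_space_1 by (simp add: emeasure_density)
  finally show ?thesis by simp
qed

lemma (in prob_space) emeasure_le_exponential:
  assumes indep: "indep_var borel Y borel S"
    and D: "distributed M lborel Y (exponential_density l)" and "0 < l"
    and S_nonneg: "AE \<omega> in M. 0 \<le> S \<omega>"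
  shows "emeasure M {\<omega> \<in> space M. S \<omega> \<le> Y \<omega>} = (\<integral>\<^sup>+\<omega>. ennreal (exp (- l * S \<omega>)) \<partial>M)"
proof -
  have [measurable]: "Y \<in> borel_measurable M" "S \<in> borel_measurable M"
    using indep by (auto dest: indep_var_rv1 indep_var_rv2)
  interpret Y: prob_space "distr M borel Y" by (rule prob_space_distr) simp
  interpret S: prob_space "distr M borel S" by (rule prob_space_distr) simp
  interpret pair_sigma_finite "distr M borel Y" "distr M borel S" ..
  let ?A = "{p. snd p \<le> fst p} :: (real \<times> real) set"
  have "{p \<in> space (borel \<Otimes>\<^sub>M borel). snd p \<le> (fst p :: real)} \<in> sets (borel \<Otimes>\<^sub>M borel)" by measurable
  hence [measurable]: "?A \<in> sets (borel \<Otimes>\<^sub>M borel)" by (simp add: space_pair_measure)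
  have "emeasure M {\<omega> \<in> space M. S \<omega> \<le> Y \<omega>} = emeasure (distr M (borel \<Otimes>\<^sub>M borel) (\<lambda>\<omega>. (Y \<omega>, S \<omega>))) ?A"
    by (subst emeasure_distr) (auto intro!: arg_cong[where f = "emeasure M"])
  also have "\<dots> = emeasure (distr M borel Y \<Otimes>\<^sub>M distr M borel S) ?A"
    using indep by (simp add: indep_var_distribution_eq)
  also have "\<dots> = (\<integral>\<^sup>+s. emeasure (distr M borel Y) ((\<lambda>y. (y, s)) -` ?A) \<partial>distr M borel S)"
    by (rule emeasure_pair_measure_alt2) simp
  also have "\<dots> = (\<integral>\<^sup>+\<omega>. emeasure (distr M borel Y) ((\<lambda>y. (y, S \<omega>)) -` ?A) \<partial>M)"
    by (subst nn_integral_distr) (auto intro!: measurable_emeasure_Pair2)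
  also have "\<dots> = (\<integral>\<^sup>+\<omega>. ennreal (exp (- l * S \<omega>)) \<partial>M)"
  proof (intro nn_integral_cong_AE eventually_mono[OF S_nonneg])
    fix \<omega> assume "0 \<le> S \<omega>"
    have "emeasure (distr M borel Y) ((\<lambda>y. (y, S \<omega>)) -` ?A) = emeasure M {\<omega>' \<in> space M. S \<omega> \<le> Y \<omega>'}"
      by (subst emeasure_distr) (auto intro!: arg_cong[where f = "emeasure M"])
    also have "\<dots> = ennreal (exp (- l * S \<omega>))"
      using exponential_distributedD_ge[OF D \<open>0 \<le> S \<omega>\<close> \<open>0 < l\<close>]
      by (simp add: emeasure_eq_measure mult.commute)
    finally show "emeasure (distr M borel Y) ((\<lambda>y. (y, S \<omega>)) -` ?A) = ennreal (exp (- l * S \<omega>))" .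
  qed
  finally show ?thesis .
qed

lemma (in prob_space) emeasure_scaled_sum_le_exponential:
  fixes Y :: "'i \<Rightarrow> 'a \<Rightarrow> real"
  assumes indep: "indep_vars (\<lambda>_. borel) Y (insert j K)" and K: "finite K" "j \<notin> K"
    and D: "\<And>k. k \<in> insert j K \<Longrightarrow> distributed M lborel (Y k) (exponential_density 1)"
    and "0 \<le> c" "0 \<le> x"
  shows "emeasure M {\<omega> \<in> space M. x * (c + (\<Sum>k\<in>K. Y k \<omega>)) \<le> Y j \<omega>}
    = ennreal (exp (- x * c) / (1 + x) ^ card K)"
proof -
  define S where "S = (\<lambda>\<omega>. x * (c + (\<Sum>k\<in>K. Y k \<omega>)))"
  have "indep_var borel ((\<lambda>y. y) \<circ> Y j) borel ((\<lambda>s. x * (c + s)) \<circ> (\<lambda>\<omega>. \<Sum>k\<in>K. Y k \<omega>))"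
    using K indep by (intro indep_var_compose[OF indep_vars_sum]) auto
  hence S_indep: "indep_var borel (Y j) borel S" by (simp add: S_def o_def)
  have "AE \<omega> in M. \<forall>k\<in>K. 0 \<le> Y k \<omega>"
    using K(1) D by (intro AE_finite_allI exponential_distributed_nonneg) auto
  hence S_nonneg: "AE \<omega> in M. 0 \<le> S \<omega>"
    by eventually_elim
       (use assms in \<open>auto simp: S_def intro!: mult_nonneg_nonneg add_nonneg_nonneg sum_nonneg\<close>)
  have exp_S: "exp (- S \<omega>) = exp (- x * c) * (\<Prod>k\<in>K. exp (- x * Y k \<omega>))" for \<omega>
  proof -
    have "- S \<omega> = - x * c + (\<Sum>k\<in>K. - x * Y k \<omega>)"
      by (simp add: S_def algebra_simps sum_distrib_left sum_negf)
    thus ?thesis using K(1) by (simp only: exp_add exp_sum)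
  qed
  have [measurable]: "Y k \<in> borel_measurable M" if "k \<in> K" for k
    using distributed_measurable[OF D, of k] that by simp
  have laplace_indep: "indep_vars (\<lambda>_. borel) (\<lambda>k \<omega>. ennreal (exp (- x * Y k \<omega>))) K"
    by (rule indep_vars_compose2[OF indep_vars_subset[OF indep]]) auto
  have "emeasure M {\<omega> \<in> space M. S \<omega> \<le> Y j \<omega>} = (\<integral>\<^sup>+\<omega>. ennreal (exp (- 1 * S \<omega>)) \<partial>M)"
    using S_indep D S_nonneg by (intro emeasure_le_exponential) auto
  also have "\<dots> = (\<integral>\<^sup>+\<omega>. ennreal (exp (- x * c)) * (\<Prod>k\<in>K. ennreal (exp (- x * Y k \<omega>))) \<partial>M)"
    by (simp add: exp_S ennreal_mult' prod_ennreal)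
  also have "\<dots> = ennreal (exp (- x * c)) * (\<Prod>k\<in>K. \<integral>\<^sup>+\<omega>. ennreal (exp (- x * Y k \<omega>)) \<partial>M)"
    using indep_vars_nn_integral[OF K(1) laplace_indep] by (subst nn_integral_cmult) auto
  also have "\<dots> = ennreal (exp (- x * c)) * (\<Prod>k\<in>K. ennreal (1 / (1 + x)))"
    using exponential_distributed_laplace[OF D] \<open>0 \<le> x\<close> by simp
  also have "\<dots> = ennreal (exp (- x * c) / (1 + x) ^ card K)"
    using \<open>0 \<le> x\<close> by (simp add: ennreal_power power_one_over flip: ennreal_mult')
  finally show ?thesis by (simp add: S_def)
qed

lemma distr_lborel_norm_power_DIM:
  "distr lborel borel (\<lambda>x :: 'a :: euclidean_space. norm x ^ DIM('a))
    = density lborel (\<lambda>s. ennreal (unit_ball_vol DIM('a)) * indicator {0..} s)" (is "?L = ?R")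
proof (rule measure_eqI_generator_eq[where E = "range (\<lambda>a :: real. {..a})" and \<Omega> = UNIV
      and A = "\<lambda>n. {..real n}"])
  have atMost: "emeasure ?L {..a} = ennreal (unit_ball_vol DIM('a) * max a 0)"
    "emeasure ?R {..a} = ennreal (unit_ball_vol DIM('a) * max a 0)" for a
  proof -
    have "(\<lambda>x :: 'a. norm x ^ DIM('a)) -` {..a} = (if 0 \<le> a then cball 0 (root DIM('a) a) else {})"
    proof (cases "0 \<le> a")
      case True
      have "norm x ^ DIM('a) \<le> a \<longleftrightarrow> norm x \<le> root DIM('a) a" for x :: 'a
        using True by (metis DIM_positive norm_ge_zero real_root_le_iff real_root_power_cancel)
      thus ?thesis using True by auto
    next
      case False
      have "\<not> norm x ^ DIM('a) \<le> a" for x :: 'a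
        using False by (meson norm_ge_zero order.trans zero_le_power)
      thus ?thesis using False by auto
    qed
    thus "emeasure ?L {..a} = ennreal (unit_ball_vol DIM('a) * max a 0)"
      by (subst emeasure_distr) (auto simp: emeasure_cball max_def)
    have "indicator {0..} s * indicator {..a} s = (indicator {0..a} s :: ennreal)" for s
      by (simp split: split_indicator)
    moreover have "emeasure lborel {0..a} = ennreal (max a 0)" by (cases "0 \<le> a") auto
    ultimately show "emeasure ?R {..a} = ennreal (unit_ball_vol DIM('a) * max a 0)"
      by (simp add: emeasure_density mult.assoc nn_integral_cmult_indicator ennreal_mult')
  qed
  show "emeasure ?L X = emeasure ?R X" if "X \<in> range (\<lambda>a. {..a})" for X
    using that atMost by auto
  show "emeasure ?L {..real n} \<noteq> \<infinity>" for n by (simp add: atMost)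
  show "(\<Union>n. {..real n}) = UNIV" using real_arch_simple by auto
qed (auto simp: Int_stable_def borel_eq_atMost)

subsection \<open>Distribution of the SINR\<close>

lemma sets_cgauss [measurable_cong, simp]: "sets cgauss = sets borel"
  by (simp add: cgauss_def)

lemma distributed_cgauss_norm_power2:
  "distributed cgauss lborel (\<lambda>z. (cmod z)\<^sup>2) (exponential_density 1)"
proof -
  let ?h = "\<lambda>s. ennreal (exp (- s) / pi)"
  have "distr cgauss lborel (\<lambda>z. (cmod z)\<^sup>2)
      = distr (density lborel (\<lambda>z. ?h ((cmod z)\<^sup>2))) borel (\<lambda>z. (cmod z)\<^sup>2)"
    by (intro distr_cong) (simp_all add: cgauss_def)
  also have "\<dots> = density (distr lborel borel (\<lambda>z. (cmod z)\<^sup>2)) ?h"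
    by (rule density_distr[symmetric]) auto
  also have "distr lborel borel (\<lambda>z. (cmod z)\<^sup>2) = density lborel (\<lambda>s. ennreal pi * indicator {0..} s)"
    using distr_lborel_norm_power_DIM[where 'a = complex] by (simp add: unit_ball_vol_2)
  also have "density \<dots> ?h = density lborel (\<lambda>s. ennreal pi * indicator {0..} s * ?h s)"
    by (intro density_density_eq) auto
  also have "\<dots> = density lborel (exponential_density 1)"
    by (intro density_cong AE_I2) (auto simp: exponential_density_def ennreal_mult'[symmetric])
  finally show ?thesis by (simp add: distributed_def)
qed

lemma prob_space_cgauss: "prob_space cgauss"
proof (rule prob_space_distrD)
  show "prob_space (distr cgauss lborel (\<lambda>z. (cmod z)\<^sup>2))"
    unfolding distributed_distr_eq_density[OF distributed_cgauss_norm_power2]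
    by (rule prob_space_exponential_density) simp
qed simp

interpretation cgauss: product_prob_space "\<lambda>_. cgauss" I for I :: "(nat \<times> nat) set"
  using prob_space_cgauss
  by (intro product_prob_space.intro product_prob_space_axioms.intro product_sigma_finite.intro
      prob_space_imp_sigma_finite)

interpretation channel: prob_space "channel_model n M" for n M
  unfolding channel_model_def by (rule cgauss.P.prob_space_axioms)

lemma indep_vars_channel:
  assumes "n > 0" "M > 0"
  shows "channel.indep_vars n M (\<lambda>_. cgauss) (\<lambda>j X. X j) ({..<n} \<times> {..<M})"
  unfolding channel_model_def using assms by (intro cgauss.indep_vars_components) auto

lemma distributed_channel_gain:
  assumes "j \<in> {..<n} \<times> {..<M}"
  shows "distributed (channel_model n M) lborel (\<lambda>X. (cmod (X j))\<^sup>2) (exponential_density 1)"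
proof -
  have component [measurable]: "(\<lambda>X. X j) \<in> channel_model n M \<rightarrow>\<^sub>M cgauss"
    using assms unfolding channel_model_def by measurable
  have "distr (channel_model n M) lborel (\<lambda>X. (cmod (X j))\<^sup>2)
      = distr (distr (channel_model n M) cgauss (\<lambda>X. X j)) lborel (\<lambda>z. (cmod z)\<^sup>2)"
    by (subst distr_distr) (auto simp: o_def)
  also have "distr (channel_model n M) cgauss (\<lambda>X. X j) = cgauss"
    using cgauss.PiM_component[OF assms] by (simp add: channel_model_def)
  finally have "distr (channel_model n M) lborel (\<lambda>X. (cmod (X j))\<^sup>2)
      = density lborel (exponential_density 1)"
    using distributed_cgauss_norm_power2 by (simp add: distributed_def)
  moreover have "(\<lambda>X. (cmod (X j))\<^sup>2) \<in> borel_measurable (channel_model n M)"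
    by (rule measurable_compose[OF component]) measurable
  ultimately show ?thesis by (simp add: distributed_def)
qed

lemma sinr_measurable_PiM:
  assumes "{i} \<times> {..<M} \<subseteq> J" "m < M"
  shows "(\<lambda>X. sinr M \<rho> X i m) \<in> borel_measurable (PiM J (\<lambda>_. cgauss))"
proof -
  have [measurable]: "(\<lambda>X. X (i, k)) \<in> PiM J (\<lambda>_. cgauss) \<rightarrow>\<^sub>M borel" if "k < M" for k
    using measurable_component_singleton[of "(i, k)" J "\<lambda>_. cgauss"] assms that
      measurable_cong_sets[OF refl sets_cgauss] by blast
  show ?thesis unfolding sinr_def
    using assms(2) by (intro borel_measurable_divide borel_measurable_add borel_measurable_sum
        borel_measurable_power borel_measurable_norm borel_measurable_const) auto
qed

lemma sinr_measurable:
  assumes "i < n" "m < M"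
  shows "(\<lambda>X. sinr M \<rho> X i m) \<in> borel_measurable (channel_model n M)"
  unfolding channel_model_def using assms by (intro sinr_measurable_PiM) auto

lemma indep_vars_sinr:
  assumes "m < M" "n > 0"
  shows "channel.indep_vars n M (\<lambda>_. borel) (\<lambda>i X. sinr M \<rho> X i m) {..<n}"
proof -
  have "channel.indep_vars n M (\<lambda>i. PiM ({i} \<times> {..<M}) (\<lambda>_. cgauss))
      (\<lambda>i X. restrict (\<lambda>j. X j) ({i} \<times> {..<M})) {..<n}"
    using assms
    by (intro channel.indep_vars_restrict[OF indep_vars_channel]) (auto simp: disjoint_family_on_def)
  hence "channel.indep_vars n M (\<lambda>_. borel)
      (\<lambda>i X. sinr M \<rho> (restrict (\<lambda>j. X j) ({i} \<times> {..<M})) i m) {..<n}"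
    by (rule channel.indep_vars_compose2) (use assms in \<open>auto intro!: sinr_measurable_PiM\<close>)
  moreover have "sinr M \<rho> (restrict (\<lambda>j. X j) ({i} \<times> {..<M})) i m = sinr M \<rho> X i m" for X i
    using assms by (simp add: sinr_def)
  ultimately show ?thesis by simp
qed

lemma sinr_nonneg: "\<rho> > 0 \<Longrightarrow> 0 \<le> sinr M \<rho> X i m"
  unfolding sinr_def by (intro divide_nonneg_nonneg add_nonneg_nonneg sum_nonneg) auto

lemma prob_sinr_ge_real:
  assumes "i < n" "m < M" "\<rho> > 0" "0 \<le> x"
  shows "channel.prob n M {X \<in> space (channel_model n M). x \<le> sinr M \<rho> X i m} = 1 - sinr_cdf M \<rho> x"
proof -
  let ?K = "Pair i ` ({..<M} - {m})"
  let ?gain = "\<lambda>j (X :: nat \<times> nat \<Rightarrow> complex). (cmod (X j))\<^sup>2"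
  have users: "insert (i, m) ?K \<subseteq> {..<n} \<times> {..<M}" using assms by auto
  have "channel.indep_vars n M (\<lambda>_. borel) ?gain ({..<n} \<times> {..<M})"
    using assms by (intro channel.indep_vars_compose2[OF indep_vars_channel]) auto
  hence indep: "channel.indep_vars n M (\<lambda>_. borel) ?gain (insert (i, m) ?K)"
    using users by (rule channel.indep_vars_subset)
  have "x \<le> sinr M \<rho> X i m \<longleftrightarrow> x * (1 / \<rho> + (\<Sum>j\<in>?K. ?gain j X)) \<le> ?gain (i, m) X" for X
  proof -
    have "0 < 1 / \<rho> + (\<Sum>k\<in>{..<M} - {m}. ?gain (i, k) X)"
      using assms(3) by (intro add_pos_nonneg sum_nonneg) auto
    thus ?thesis by (simp add: sinr_def pos_le_divide_eq sum.reindex inj_on_def)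
  qed
  hence "emeasure (channel_model n M) {X \<in> space (channel_model n M). x \<le> sinr M \<rho> X i m}
      = emeasure (channel_model n M)
          {X \<in> space (channel_model n M). x * (1 / \<rho> + (\<Sum>j\<in>?K. ?gain j X)) \<le> ?gain (i, m) X}"
    by simp
  also have "\<dots> = ennreal (exp (- x * (1 / \<rho>)) / (1 + x) ^ card ?K)"
  proof (rule channel.emeasure_scaled_sum_le_exponential[OF indep])
    show "distributed (channel_model n M) lborel (?gain j) (exponential_density 1)"
      if "j \<in> insert (i, m) ?K" for j
      using users that by (intro distributed_channel_gain) blast
  qed (use assms in auto)
  also have "card ?K = M - 1" using assms(2) by (simp add: card_image inj_on_def)
  finally show ?thesis
    using assms(4) by (simp add: measure_def sinr_cdf_def add.commute)
qed

lemma sinr_cdf_0: "sinr_cdf M \<rho> 0 = 0"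
  by (simp add: sinr_cdf_def)

lemma sinr_cdf_strict_mono:
  assumes "0 \<le> x" "x < y" "\<rho> > 0"
  shows "sinr_cdf M \<rho> x < sinr_cdf M \<rho> y"
proof -
  have "exp (- y / \<rho>) / (y + 1) ^ (M - 1) < exp (- x / \<rho>) / (x + 1) ^ (M - 1)"
    using assms by (intro frac_less) (auto intro!: power_mono divide_strict_right_mono)
  thus ?thesis by (simp add: sinr_cdf_def)
qed

lemma sinr_cdf_bounds:
  assumes "0 \<le> x" "\<rho> > 0"
  shows "0 \<le> sinr_cdf M \<rho> x" and "sinr_cdf M \<rho> x < 1"
proof -
  show "0 \<le> sinr_cdf M \<rho> x"
    using assms sinr_cdf_strict_mono[of 0 x \<rho> M] by (cases "x = 0") (auto simp: sinr_cdf_0)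
  show "sinr_cdf M \<rho> x < 1" using assms by (simp add: sinr_cdf_def)
qed

lemma continuous_on_sinr_cdf: "continuous_on {0..} (sinr_cdf M \<rho>)"
  unfolding sinr_cdf_def[abs_def] divide_inverse by (auto intro!: continuous_intros)

lemma sinr_cdf_tendsto:
  assumes "\<rho> > 0"
  shows "(sinr_cdf M \<rho> \<longlongrightarrow> 1) at_top"
proof -
  have "((\<lambda>x. exp (- x / \<rho>) / (x + 1) ^ (M - 1)) \<longlongrightarrow> 0) at_top"
  proof (rule real_tendsto_sandwich)
    show "\<forall>\<^sub>F x in at_top. exp (- x / \<rho>) / (x + 1) ^ (M - 1) \<le> exp (- x / \<rho>)"
      using eventually_ge_at_top[of 0]
      by eventually_elim (simp add: divide_le_eq mult_le_cancel_left1 one_le_power)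
    show "\<forall>\<^sub>F x in at_top. 0 \<le> exp (- x / \<rho>) / (x + 1) ^ (M - 1)"
      using eventually_ge_at_top[of 0] by eventually_elim simp
    show "((\<lambda>x. exp (- x / \<rho>)) \<longlongrightarrow> 0) at_top" using assms by real_asymp
  qed auto
  from tendsto_diff[OF tendsto_const[of 1] this] show ?thesis
    by (simp add: sinr_cdf_def[abs_def])
qed

definition sinr_tail :: "nat \<Rightarrow> real \<Rightarrow> ereal \<Rightarrow> real" where
  "sinr_tail M \<rho> t = (if t = \<infinity> then 0 else 1 - sinr_cdf M \<rho> (real_of_ereal t))"

lemma sinr_tail_simps [simp]:
  "sinr_tail M \<rho> \<infinity> = 0" "sinr_tail M \<rho> (ereal x) = 1 - sinr_cdf M \<rho> x"
  by (simp_all add: sinr_tail_def)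

lemma prob_sinr_ge:
  assumes "i < n" "m < M" "\<rho> > 0" "0 \<le> t"
  shows "channel.prob n M {X \<in> space (channel_model n M). t \<le> ereal (sinr M \<rho> X i m)} = sinr_tail M \<rho> t"
  using assms prob_sinr_ge_real[of i n m M \<rho>] by (cases t) auto

lemma feedback_prob_eq_sinr_tail:
  assumes "i < n" "M > 0" "\<rho> > 0" "0 \<le> \<tau> i"
  shows "feedback_prob n M \<rho> \<tau> i = sinr_tail M \<rho> (\<tau> i)"
  unfolding feedback_prob_def using assms by (intro prob_sinr_ge) auto

lemma sinr_tail_bounds:
  assumes "0 \<le> t" "\<rho> > 0"
  shows "0 \<le> sinr_tail M \<rho> t" and "sinr_tail M \<rho> t \<le> 1"
  using assms sinr_cdf_bounds[of _ \<rho> M] by (cases t; force)+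

lemma sinr_tail_antimono:
  assumes "0 \<le> s" "s \<le> t" "\<rho> > 0"
  shows "sinr_tail M \<rho> t \<le> sinr_tail M \<rho> s"
proof (cases t)
  case (real y)
  then obtain x where x: "s = ereal x" using assms by (cases s) auto
  show ?thesis
    using real x assms sinr_cdf_strict_mono[of x y \<rho> M] by (cases "x = y") auto
qed (use assms sinr_tail_bounds in auto)

lemma sinr_tail_max:
  assumes "0 \<le> s" "0 \<le> t" "\<rho> > 0"
  shows "sinr_tail M \<rho> (max s t) = min (sinr_tail M \<rho> s) (sinr_tail M \<rho> t)"
  using assms sinr_tail_antimono[of s t \<rho> M] sinr_tail_antimono[of t s \<rho> M]
  by (auto simp: max_def min_def)

lemma
  assumes "0 \<le> p" "p \<le> 1" "\<rho> > 0"
  shows tau_of_prob_nonneg: "0 \<le> tau_of_prob M \<rho> p"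
    and sinr_tail_tau_of_prob: "sinr_tail M \<rho> (tau_of_prob M \<rho> p) = p"
proof -
  have "0 \<le> tau_of_prob M \<rho> p \<and> sinr_tail M \<rho> (tau_of_prob M \<rho> p) = p"
  proof (cases "p = 0")
    case False
    obtain x where "0 \<le> x" "sinr_cdf M \<rho> x = 1 - p"
      using IVT_at_top[OF continuous_on_sinr_cdf sinr_cdf_tendsto[OF assms(3)], of M "1 - p"]
        assms False by (auto simp: sinr_cdf_0)
    hence "\<exists>!x. 0 \<le> x \<and> sinr_cdf M \<rho> x = 1 - p"
      using sinr_cdf_strict_mono[OF _ _ assms(3), of _ _ M] by (metis linorder_neq_iff)
    from theI'[OF this] show ?thesis using False by (simp add: tau_of_prob_def)
  qed (simp add: tau_of_prob_def)
  thus "0 \<le> tau_of_prob M \<rho> p" "sinr_tail M \<rho> (tau_of_prob M \<rho> p) = p" by auto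
qed

subsection \<open>The sum rate\<close>

definition log_sinr_cdf :: "nat \<Rightarrow> real \<Rightarrow> real \<Rightarrow> real" where
  "log_sinr_cdf M \<rho> u = sinr_cdf M \<rho> (exp u - 1)"

definition log_sinr_pdf :: "nat \<Rightarrow> real \<Rightarrow> real \<Rightarrow> real" where
  "log_sinr_pdf M \<rho> u = (1 - log_sinr_cdf M \<rho> u) * (exp u / \<rho> + real (M - 1))"

lemma log_sinr_cdf_eq: "log_sinr_cdf M \<rho> u = 1 - exp (- (exp u - 1) / \<rho> - real (M - 1) * u)"
  by (simp add: log_sinr_cdf_def sinr_cdf_def exp_diff exp_of_nat_mult)

lemma DERIV_log_sinr_cdf:
  "\<rho> > 0 \<Longrightarrow> (log_sinr_cdf M \<rho> has_real_derivative log_sinr_pdf M \<rho> u) (at u)"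
  unfolding log_sinr_pdf_def log_sinr_cdf_eq[abs_def]
  by (auto intro!: derivative_eq_intros simp: field_simps)

lemma log_sinr_pdf_antimono:
  assumes "M > 1" "\<rho> > 0" "u \<le> v"
  shows "log_sinr_pdf M \<rho> v \<le> log_sinr_pdf M \<rho> u"
proof (rule DERIV_nonpos_imp_nonincreasing[OF assms(3)])
  fix x
  define tail where "tail = 1 - log_sinr_cdf M \<rho> x"
  define e where "e = exp x / \<rho>"
  define hazard where "hazard = e + real (M - 1)"
  have pdf: "log_sinr_pdf M \<rho> x = tail * hazard"
    by (simp add: log_sinr_pdf_def tail_def e_def hazard_def)
  have "(log_sinr_pdf M \<rho> has_real_derivative tail * e - log_sinr_pdf M \<rho> x * hazard) (at x)"
    unfolding log_sinr_pdf_def[abs_def] tail_def e_def hazard_def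
    using assms(2) by (auto intro!: derivative_eq_intros DERIV_log_sinr_cdf simp: log_sinr_pdf_def)
  moreover have "tail * e - log_sinr_pdf M \<rho> x * hazard \<le> 0"
  proof -
    have "0 \<le> tail" "0 \<le> e" "1 \<le> real (M - 1)"
      using assms by (auto simp: tail_def log_sinr_cdf_eq e_def)
    hence "0 \<le> tail" "0 \<le> e" "1 \<le> hazard" "e \<le> hazard" unfolding hazard_def by linarith+
    hence "tail * (e * 1) \<le> tail * (hazard * hazard)" by (intro mult_left_mono mult_mono) auto
    thus ?thesis by (simp add: pdf mult.assoc)
  qed
  ultimately show "\<exists>y. (log_sinr_pdf M \<rho> has_real_derivative y) (at x) \<and> y \<le> 0" by blast
qed

lemma log_sinr_tail_integrable:
  assumes "M > 1" "\<rho> > 0"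
  shows "set_integrable lborel {0<..} (\<lambda>u. 1 - log_sinr_cdf M \<rho> u)"
proof (rule set_integrable_bound)
  show "set_integrable lborel {0<..} (\<lambda>u :: real. exp (- u))"
    using integrable_I0i_exp_mscale[of 1] by simp
  show "set_borel_measurable lborel {0<..} (\<lambda>u. 1 - log_sinr_cdf M \<rho> u)"
    unfolding set_borel_measurable_def log_sinr_cdf_eq by measurable
  have "1 - log_sinr_cdf M \<rho> u \<le> exp (- u)" if "0 < u" for u
  proof -
    have "1 * u \<le> real (M - 1) * u" using that assms by (intro mult_right_mono) auto
    moreover have "0 \<le> (exp u - 1) / \<rho>" using that assms by simp
    ultimately show ?thesis by (simp add: log_sinr_cdf_eq diff_divide_distrib)
  qed
  thus "AE u in lborel. u \<in> {0<..} \<longrightarrow> norm (1 - log_sinr_cdf M \<rho> u) \<le> norm (exp (- u))"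
    by (auto simp: log_sinr_cdf_eq)
qed

lemma concave_cdf_log_sinr:
  assumes "M > 1" "\<rho> > 0"
  shows "concave_cdf (log_sinr_cdf M \<rho>) (log_sinr_pdf M \<rho>)"
proof
  show "(log_sinr_cdf M \<rho> has_real_derivative log_sinr_pdf M \<rho> u) (at u)" for u
    using assms(2) by (rule DERIV_log_sinr_cdf)
  show "0 < log_sinr_pdf M \<rho> u" for u
    using assms by (simp add: log_sinr_pdf_def log_sinr_cdf_eq add_pos_nonneg)
  show "isCont (log_sinr_pdf M \<rho>) u" for u
    unfolding log_sinr_pdf_def[abs_def] log_sinr_cdf_eq using assms by (intro continuous_intros) auto
  have "filterlim (\<lambda>u::real. exp u - 1) at_top at_top" by real_asymp
  from filterlim_compose[OF sinr_cdf_tendsto[OF assms(2)] this]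
  show "(log_sinr_cdf M \<rho> \<longlongrightarrow> 1) at_top" by (simp add: log_sinr_cdf_def[abs_def])
  show "log_sinr_cdf M \<rho> 0 = 0" by (simp add: log_sinr_cdf_def sinr_cdf_0)
qed (use assms in \<open>auto intro!: log_sinr_pdf_antimono log_sinr_tail_integrable\<close>)

lemma trunc_sinr_nonneg: "\<rho> > 0 \<Longrightarrow> 0 \<le> trunc_sinr M \<rho> \<tau> X i m"
  by (simp add: trunc_sinr_def sinr_nonneg)

lemma indep_vars_trunc_sinr:
  assumes "m < M" "n > 0"
  shows "channel.indep_vars n M (\<lambda>_. borel) (\<lambda>i X. trunc_sinr M \<rho> \<tau> X i m) {..<n}"
  unfolding trunc_sinr_def
  by (rule channel.indep_vars_compose2[OF indep_vars_sinr[OF assms],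
        where Y = "\<lambda>i y. if \<tau> i \<le> ereal y then y else 0"]) measurable

lemma prob_trunc_sinr_less:
  assumes "i < n" "m < M" "\<rho> > 0" "0 \<le> \<tau> i" "0 < x"
  shows "channel.prob n M {X \<in> space (channel_model n M). trunc_sinr M \<rho> \<tau> X i m < x}
    = max (sinr_cdf M \<rho> x) (1 - sinr_tail M \<rho> (\<tau> i))"
proof -
  let ?P = "channel_model n M"
  note sinr_measurable[OF assms(1,2), measurable]
  let ?A = "{X \<in> space ?P. max (\<tau> i) (ereal x) \<le> ereal (sinr M \<rho> X i m)}"
  have "{X \<in> space ?P. trunc_sinr M \<rho> \<tau> X i m < x} = space ?P - ?A"
    using assms(5) by (auto simp: trunc_sinr_def not_le)
  moreover have "?A \<in> sets ?P" by measurable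
  ultimately have "channel.prob n M {X \<in> space ?P. trunc_sinr M \<rho> \<tau> X i m < x}
      = 1 - sinr_tail M \<rho> (max (\<tau> i) (ereal x))"
    using assms channel.prob_compl[of ?A] prob_sinr_ge[of i n m M \<rho> "max (\<tau> i) (ereal x)"]
    by (simp add: le_max_iff_disj)
  also have "\<dots> = max (sinr_cdf M \<rho> x) (1 - sinr_tail M \<rho> (\<tau> i))"
    using assms by (subst sinr_tail_max) (auto simp: min_def max_def)
  finally show ?thesis .
qed

definition max_rate :: "nat \<Rightarrow> nat \<Rightarrow> real \<Rightarrow> (nat \<Rightarrow> ereal) \<Rightarrow> nat \<Rightarrow> (nat \<times> nat \<Rightarrow> complex) \<Rightarrow> real" where
  "max_rate n M \<rho> \<tau> m X = ln (1 + Max ((\<lambda>i. trunc_sinr M \<rho> \<tau> X i m) ` {..<n}))"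

lemma max_rate_measurable:
  assumes "m < M" "n > 0"
  shows "max_rate n M \<rho> \<tau> m \<in> borel_measurable (channel_model n M)"
proof -
  have "(\<lambda>X. trunc_sinr M \<rho> \<tau> X i m) \<in> borel_measurable (channel_model n M)" if "i < n" for i
    using indep_vars_trunc_sinr[OF assms] that by (auto simp: channel.indep_vars_def)
  hence [measurable]: "(\<lambda>X. Max ((\<lambda>i. trunc_sinr M \<rho> \<tau> X i m) ` {..<n}))
      \<in> borel_measurable (channel_model n M)"
    by (intro borel_measurable_Max) auto
  show ?thesis unfolding max_rate_def[abs_def] by measurable
qed

lemma Max_trunc_sinr_nonneg:
  assumes "\<rho> > 0" "n > 0"
  shows "0 \<le> Max ((\<lambda>i. trunc_sinr M \<rho> \<tau> X i m) ` {..<n})"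
proof -
  have "0 \<le> trunc_sinr M \<rho> \<tau> X 0 m" using assms(1) by (rule trunc_sinr_nonneg)
  also have "\<dots> \<le> Max ((\<lambda>i. trunc_sinr M \<rho> \<tau> X i m) ` {..<n})" using assms(2) by (intro Max_ge) auto
  finally show ?thesis .
qed

lemma prob_max_rate_ge:
  assumes "\<rho> > 0" "m < M" "n > 0" "\<forall>i<n. 0 \<le> \<tau> i" "0 < u"
  shows "channel.prob n M {X \<in> space (channel_model n M). u \<le> max_rate n M \<rho> \<tau> m X}
    = trunc_max_tail (log_sinr_cdf M \<rho>) n (\<lambda>i. sinr_tail M \<rho> (\<tau> i)) u"
proof -
  let ?P = "channel_model n M"
  let ?A = "{X \<in> space ?P. u \<le> max_rate n M \<rho> \<tau> m X}"
  note max_rate_measurable[OF assms(2,3), measurable]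
  have "u \<le> max_rate n M \<rho> \<tau> m X \<longleftrightarrow> \<not> Max ((\<lambda>i. trunc_sinr M \<rho> \<tau> X i m) ` {..<n}) < exp u - 1" for X
    using Max_trunc_sinr_nonneg[OF assms(1,3), of M \<tau> X m] by (auto simp: max_rate_def ln_ge_iff)
  hence "space ?P - ?A = {X \<in> space ?P. Max ((\<lambda>i. trunc_sinr M \<rho> \<tau> X i m) ` {..<n}) < exp u - 1}"
    by blast
  hence "channel.prob n M (space ?P - ?A)
      = channel.prob n M {X \<in> space ?P. Max ((\<lambda>i. trunc_sinr M \<rho> \<tau> X i m) ` {..<n}) < exp u - 1}"
    by simp
  also have "\<dots> = (\<Prod>i<n. channel.prob n M {X \<in> space ?P. trunc_sinr M \<rho> \<tau> X i m < exp u - 1})"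
    using assms(3) by (intro channel.prob_Max_less indep_vars_trunc_sinr[OF assms(2,3)]) auto
  also have "\<dots> = (\<Prod>i<n. max (log_sinr_cdf M \<rho> u) (1 - sinr_tail M \<rho> (\<tau> i)))"
  proof (rule prod.cong[OF refl])
    fix i assume "i \<in> {..<n}"
    thus "channel.prob n M {X \<in> space ?P. trunc_sinr M \<rho> \<tau> X i m < exp u - 1}
        = max (log_sinr_cdf M \<rho> u) (1 - sinr_tail M \<rho> (\<tau> i))"
      unfolding log_sinr_cdf_def using assms by (intro prob_trunc_sinr_less) auto
  qed
  finally show ?thesis by (simp add: channel.prob_compl trunc_max_tail_def)
qed

lemma has_bochner_integral_max_rate:
  assumes "M > 1" "\<rho> > 0" "m < M" "n > 0" "\<forall>i<n. 0 \<le> \<tau> i"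
  shows "has_bochner_integral (channel_model n M) (max_rate n M \<rho> \<tau> m)
    (trunc_max_mean (log_sinr_cdf M \<rho>) n (\<lambda>i. sinr_tail M \<rho> (\<tau> i)))"
proof (rule has_bochner_integral_nn_integral)
  let ?P = "channel_model n M" and ?F = "log_sinr_cdf M \<rho>" and ?p = "\<lambda>i. sinr_tail M \<rho> (\<tau> i)"
  interpret concave_cdf ?F "log_sinr_pdf M \<rho>"
    using assms(1,2) by (rule concave_cdf_log_sinr)
  have tail_nonneg: "\<forall>i<n. 0 \<le> ?p i" using assms sinr_tail_bounds by blast
  show "max_rate n M \<rho> \<tau> m \<in> borel_measurable ?P" using assms by (intro max_rate_measurable)
  show "AE X in ?P. 0 \<le> max_rate n M \<rho> \<tau> m X"
    using Max_trunc_sinr_nonneg[OF assms(2,4)] by (simp add: max_rate_def)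
  show "0 \<le> trunc_max_mean ?F n ?p"
    using tail_nonneg by (rule trunc_max_mean_nonneg)
  have "(\<integral>\<^sup>+X. ennreal (max_rate n M \<rho> \<tau> m X) \<partial>?P)
      = (\<integral>\<^sup>+u\<in>{0<..}. emeasure ?P {X \<in> space ?P. u \<le> max_rate n M \<rho> \<tau> m X} \<partial>lborel)"
    using assms by (intro channel.nn_integral_layer_cake max_rate_measurable)
  also have "\<dots> = (\<integral>\<^sup>+u\<in>{0<..}. ennreal (trunc_max_tail ?F n ?p u) \<partial>lborel)"
    using assms by (intro nn_integral_cong)
      (simp add: channel.emeasure_eq_measure prob_max_rate_ge split: split_indicator)
  also have "\<dots> = ennreal (trunc_max_mean ?F n ?p)"
    using tail_nonneg by (rule nn_integral_trunc_max_tail)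
  finally show "(\<integral>\<^sup>+X. ennreal (max_rate n M \<rho> \<tau> m X) \<partial>?P)
    = ennreal (trunc_max_mean ?F n ?p)" .
qed

lemma sum_rate_eq_trunc_max_mean:
  assumes "M > 1" "\<rho> > 0" "n > 0" "\<forall>i<n. 0 \<le> \<tau> i"
  shows "sum_rate n M \<rho> \<tau> = M * trunc_max_mean (log_sinr_cdf M \<rho>) n (\<lambda>i. sinr_tail M \<rho> (\<tau> i))"
proof -
  have "has_bochner_integral (channel_model n M) (\<lambda>X. \<Sum>m<M. max_rate n M \<rho> \<tau> m X)
      (\<Sum>m<M. trunc_max_mean (log_sinr_cdf M \<rho>) n (\<lambda>i. sinr_tail M \<rho> (\<tau> i)))"
    using assms by (intro has_bochner_integral_sum has_bochner_integral_max_rate) auto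
  thus ?thesis
    by (simp add: sum_rate_def max_rate_def has_bochner_integral_integral_eq)
qed

lemma sum_rate_p_eq_trunc_max_mean:
  assumes "M > 1" "\<rho> > 0" "n > 0" "\<forall>i<n. p i \<in> {0..1}"
  shows "sum_rate_p n M \<rho> p = M * trunc_max_mean (log_sinr_cdf M \<rho>) n p"
proof -
  have "trunc_max_mean (log_sinr_cdf M \<rho>) n (\<lambda>i. sinr_tail M \<rho> (tau_of_prob M \<rho> (p i)))
      = trunc_max_mean (log_sinr_cdf M \<rho>) n p"
    using assms by (intro trunc_max_mean_cong sinr_tail_tau_of_prob) auto
  thus ?thesis
    unfolding sum_rate_p_def using assms
    by (subst sum_rate_eq_trunc_max_mean) (auto intro: tau_of_prob_nonneg)
qed

lemma schur_concave_sum_rate_p: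
  assumes "M > 1" "\<rho> > 0" "n > 0"
  shows "schur_concave_on n {p. \<forall>i<n. 0 \<le> p i \<and> p i \<le> 1} (sum_rate_p n M \<rho>)"
proof -
  interpret concave_cdf "log_sinr_cdf M \<rho>" "log_sinr_pdf M \<rho>"
    using assms(1,2) by (rule concave_cdf_log_sinr)
  show ?thesis
    using schur_concave_trunc_max_mean[of n] assms
    by (auto simp: schur_concave_on_def sum_rate_p_eq_trunc_max_mean intro!: mult_left_mono)
qed

lemma sum_rate_eq_sum_rate_p:
  assumes "M > 1" "\<rho> > 0" "n > 0" "\<forall>i<n. 0 \<le> \<tau> i"
  shows "sum_rate n M \<rho> \<tau> = sum_rate_p n M \<rho> (feedback_prob n M \<rho> \<tau>)"
proof -
  have "feedback_prob n M \<rho> \<tau> i = sinr_tail M \<rho> (\<tau> i)" if "i < n" for i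
    using assms that by (intro feedback_prob_eq_sinr_tail) auto
  moreover from this have "\<forall>i<n. feedback_prob n M \<rho> \<tau> i \<in> {0..1}"
    using assms by (simp add: sinr_tail_bounds)
  ultimately show ?thesis
    using assms
    by (simp add: sum_rate_eq_trunc_max_mean sum_rate_p_eq_trunc_max_mean cong: trunc_max_mean_cong)
qed

lemma homogeneous_threshold_dominates:
  assumes "M > 1" "\<rho> > 0" "n > 0" "\<forall>i<n. 0 \<le> \<tau> i"
  obtains t where "0 \<le> t"
    "(\<Sum>i<n. feedback_prob n M \<rho> (\<lambda>_. t) i) = (\<Sum>i<n. feedback_prob n M \<rho> \<tau> i)"
    "sum_rate n M \<rho> \<tau> \<le> sum_rate n M \<rho> (\<lambda>_. t)"
proof -
  let ?p = "feedback_prob n M \<rho> \<tau>"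
  define \<mu> where "\<mu> = (\<Sum>i<n. ?p i) / n"
  define t where "t = tau_of_prob M \<rho> \<mu>"
  have p: "0 \<le> ?p i \<and> ?p i \<le> 1" for i by (simp add: feedback_prob_def)
  have "(\<Sum>i<n. ?p i) \<le> (\<Sum>i<n. 1)" using p by (intro sum_mono) auto
  hence \<mu>: "0 \<le> \<mu>" "\<mu> \<le> 1"
    using p assms(3) by (auto simp: \<mu>_def divide_le_eq intro!: divide_nonneg_nonneg sum_nonneg)
  have t: "0 \<le> t" using \<mu> assms(2) by (simp add: t_def tau_of_prob_nonneg)
  have "feedback_prob n M \<rho> (\<lambda>_. t) i = \<mu>" if "i < n" for i
    using t \<mu> that assms by (subst feedback_prob_eq_sinr_tail) (auto simp: t_def sinr_tail_tau_of_prob)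
  hence "(\<Sum>i<n. feedback_prob n M \<rho> (\<lambda>_. t) i) = (\<Sum>i<n. ?p i)"
    using assms(3) by (simp add: \<mu>_def)
  moreover have "sum_rate n M \<rho> \<tau> \<le> sum_rate n M \<rho> (\<lambda>_. t)"
  proof -
    have "sum_rate n M \<rho> \<tau> = sum_rate_p n M \<rho> ?p" using assms by (rule sum_rate_eq_sum_rate_p)
    also have "\<dots> \<le> sum_rate_p n M \<rho> (\<lambda>_. \<mu>)"
      using schur_concave_sum_rate_p[OF assms(1-3)] majorizes_mean[OF assms(3), of ?p] p \<mu>
      by (simp add: schur_concave_on_def \<mu>_def)
    also have "\<dots> = sum_rate n M \<rho> (\<lambda>_. t)" by (simp add: sum_rate_p_def t_def)
    finally show ?thesis .
  qed
  ultimately show thesis by (rule that[OF t])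
qed

theorem theorem3:
  fixes n M :: nat and \<rho> :: real
  assumes "n \<ge> 2" and "M > 1" and "\<rho> > 0"
  shows "schur_concave_on n {p. \<forall>i<n. 0 \<le> p i \<and> p i \<le> 1} (sum_rate_p n M \<rho>)
     \<and> (\<forall>lam::real. 0 < lam \<and> lam \<le> real n \<longrightarrow>
          (\<forall>\<tau>::nat \<Rightarrow> ereal. (\<forall>i<n. 0 \<le> \<tau> i) \<and> (\<Sum>i<n. feedback_prob n M \<rho> \<tau> i) \<le> lam \<longrightarrow>
             (\<exists>t::ereal. 0 \<le> t \<and> (\<Sum>i<n. feedback_prob n M \<rho> (\<lambda>_. t) i) \<le> lam
                \<and> sum_rate n M \<rho> (\<lambda>_. t) \<ge> sum_rate n M \<rho> \<tau>)))"
proof (intro conjI allI impI)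
  have n: "n > 0" using assms(1) by simp
  show "schur_concave_on n {p. \<forall>i<n. 0 \<le> p i \<and> p i \<le> 1} (sum_rate_p n M \<rho>)"
    using assms(2,3) n by (rule schur_concave_sum_rate_p)
  fix lam :: real and \<tau> :: "nat \<Rightarrow> ereal"
  assume \<tau>: "(\<forall>i<n. 0 \<le> \<tau> i) \<and> (\<Sum>i<n. feedback_prob n M \<rho> \<tau> i) \<le> lam"
  obtain t where "0 \<le> t"
    "(\<Sum>i<n. feedback_prob n M \<rho> (\<lambda>_. t) i) = (\<Sum>i<n. feedback_prob n M \<rho> \<tau> i)"
    "sum_rate n M \<rho> \<tau> \<le> sum_rate n M \<rho> (\<lambda>_. t)"
    using homogeneous_threshold_dominates[OF assms(2,3) n conjunct1[OF \<tau>]] .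
  thus "\<exists>t\<ge>0. (\<Sum>i<n. feedback_prob n M \<rho> (\<lambda>_. t) i) \<le> lam
      \<and> sum_rate n M \<rho> \<tau> \<le> sum_rate n M \<rho> (\<lambda>_. t)"
    using \<tau> by (intro exI[of _ t]) simp
qed

end
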